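(* Let $\Delta_n$ denote the maximum degree of a graph drawn uniformly at random from the graphs in $\mathrm{Ex}(C_6)$ with $n$ vertices. Then there is a constant $C>0$ such that $$\Delta_n \le C\frac{\log n}{\log\log\log n}\qquad\text{w.h.p.}$$
   Context: All graphs are labelled. $\mathrm{Ex}(C_6)$ is the class of labelled graphs not containing the 6-cycle $C_6$ as a minor; a random graph of size $n$ is drawn uniformly from the graphs in the class on vertex set $\{1,\dots,n\}$. An event holds with high probability (w.h.p.) if its probability tends to $1$ as $n\to\infty$. $\log$ is the natural logarithm. *)

theory Defs
  imports "HOL-Probability.Probability"
begin

type_synonym 'a ugraph = "'a set \<times> 'a set set"

abbreviation verts :: "'a ugraph \<Rightarrow> 'a set" where "verts \<equiv> fst"
abbreviation edges :: "'a ugraph \<Rightarrow> 'a set set" where "edges \<equiv> snd"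

definition simple_graph :: "'a ugraph \<Rightarrow> bool" where
  "simple_graph G \<longleftrightarrow> finite (verts G) \<and> edges G \<subseteq> {e. e \<subseteq> verts G \<and> card e = 2}"

definition vertex_degree :: "'a ugraph \<Rightarrow> 'a \<Rightarrow> nat" where
  "vertex_degree G v = card {e \<in> edges G. v \<in> e}"

text \<open>Only meaningful for graphs with at least one vertex.\<close>
definition max_degree :: "'a ugraph \<Rightarrow> nat" where
  "max_degree G = Max (vertex_degree G ` verts G)"

definition connected_in :: "'a ugraph \<Rightarrow> 'a set \<Rightarrow> bool" where
  "connected_in G B \<longleftrightarrow> B \<noteq> {} \<and> B \<subseteq> verts G \<and>
     (\<forall>x\<in>B. \<forall>y\<in>B. (x, y) \<in> {(u, v). u \<in> B \<and> v \<in> B \<and> {u, v} \<in> edges G}\<^sup>*)"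

text \<open>\<open>H\<close> is (isomorphic to) a minor of \<open>G\<close>: contracting the disjoint connected branch sets
  \<open>B v\<close> to single vertices and then deleting vertices and edges yields a copy of \<open>H\<close>.\<close>
definition minor_of :: "'b ugraph \<Rightarrow> 'a ugraph \<Rightarrow> bool" where
  "minor_of H G \<longleftrightarrow> (\<exists>B.
     (\<forall>v\<in>verts H. connected_in G (B v)) \<and>
     disjoint_family_on B (verts H) \<and>
     (\<forall>u\<in>verts H. \<forall>v\<in>verts H. {u, v} \<in> edges H \<longrightarrow>
        (\<exists>x\<in>B u. \<exists>y\<in>B v. {x, y} \<in> edges G)))"

text \<open>For \<open>k \<ge> 3\<close>, the cycle of length \<open>k\<close>.\<close>
definition cycle_graph :: "nat \<Rightarrow> nat ugraph" where
  "cycle_graph k = ({0..<k}, {{i, Suc i mod k} | i. i < k})"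

definition labelled_graphs :: "nat \<Rightarrow> nat ugraph set" where
  "labelled_graphs n = {G. simple_graph G \<and> verts G = {1..n}}"

definition Ex_minor :: "'b ugraph \<Rightarrow> nat \<Rightarrow> nat ugraph set" where
  "Ex_minor H n = {G \<in> labelled_graphs n. \<not> minor_of H G}"

lemma finite_labelled_graphs: "finite (labelled_graphs n)"
proof (rule finite_subset)
  show "labelled_graphs n \<subseteq> {{1..n}} \<times> Pow (Pow {1..n})"
    unfolding labelled_graphs_def simple_graph_def by (auto simp: subset_iff)
qed auto

lemma finite_Ex_minor: "finite (Ex_minor H n)"
  by (rule finite_subset[OF _ finite_labelled_graphs[of n]]) (auto simp: Ex_minor_def)

text \<open>Hence the uniform distribution on this set is well defined for every \<open>n\<close>.\<close>
lemma Ex_minor_cycle_nonempty: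
  assumes "k > 0"
  shows "Ex_minor (cycle_graph k) n \<noteq> {}"
proof -
  have "\<not> minor_of (cycle_graph k) ({1..n}, {})"
  proof
    assume "minor_of (cycle_graph k) ({1..n}, {})"
    moreover have "0 \<in> verts (cycle_graph k)" "Suc 0 mod k \<in> verts (cycle_graph k)"
      "{0, Suc 0 mod k} \<in> edges (cycle_graph k)"
      using assms by (auto simp: cycle_graph_def)
    ultimately show False unfolding minor_of_def by fastforce
  qed
  moreover have "({1..n}, {}) \<in> labelled_graphs n"
    by (simp add: labelled_graphs_def simple_graph_def)
  ultimately show ?thesis by (auto simp: Ex_minor_def)
qed

end

theory Submission
  imports Defs "HOL-Combinatorics.Multiset_Permutations" "HOL-Real_Asymp.Real_Asymp"
begin

text \<open>
  A graph has no \<open>C\<^sub>6\<close>-minor iff all its cycles have length at most \<open>5\<close>. The theorem follows by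
  double counting from two bounds for a vertex \<open>v\<close> of degree \<open>d\<close>; write \<open>\<mu> \<approx> d / \<surd>(log d)\<close>.

  If \<open>v\<close> has neighbours in at least \<open>\<mu>\<close> components of \<open>G - v\<close>, pick one neighbour in each of \<open>\<mu>\<close>
  of them and string these components into a chain, hanging each one from the chosen neighbour of
  \<open>v\<close> in the previous one. The \<open>\<mu>!\<close> orders give different graphs of the class, and \<open>G\<close> and
  the order are recovered from the chain and its two ends. So such pairs \<open>(G, v)\<close> make up a
  proportion of at most \<open>n\<^sup>2 / \<mu>!\<close>.

  Otherwise, a component of \<open>G - v\<close> with \<open>s\<close> neighbours of \<open>v\<close> has a hub adjacent to about \<open>s / 3\<close>
  of them, and all but two of these are cut off from everything else that is adjacent to \<open>v\<close> or to the
  hub once \<open>v\<close> and the hub are removed. Cutting the edges from the hubs to \<open>k \<approx> d / 6\<close> such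
  neighbours, while keeping two for each hub so that it can be recognised, leaves a graph in which
  \<open>v\<close> has neighbours in \<open>k\<close> components, and at most \<open>4\<^sup>d \<mu>\<^sup>k\<close> graphs lead to the same result. By
  the first bound the proportion is at most \<open>n\<^sup>2 4\<^sup>d \<mu>\<^sup>k / k!\<close>.

  Both proportions are \<open>n\<^sup>2 exp(- \<Omega>(d log log d))\<close>.
\<close>

section \<open>Reachability\<close>

text \<open>Reflexive even at vertices of \<open>X\<close>: the conditions sit on the steps, so a
  trivial walk may start in \<open>X\<close>. \<open>reach_notin\<close> therefore assumes that the
  start avoids \<open>X\<close>.\<close>

definition reach :: "('a \<Rightarrow> 'a \<Rightarrow> bool) \<Rightarrow> 'a set \<Rightarrow> 'a \<Rightarrow> 'a \<Rightarrow> bool" where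
  "reach R X = (\<lambda>a b. R a b \<and> a \<notin> X \<and> b \<notin> X)\<^sup>*\<^sup>*"

lemma reach_refl [simp]: "reach R X a a"
  by (simp add: reach_def)

lemma reach_trans: "reach R X a b \<Longrightarrow> reach R X b c \<Longrightarrow> reach R X a c"
  unfolding reach_def by (rule rtranclp_trans)

lemma reach_edge: "R a b \<Longrightarrow> a \<notin> X \<Longrightarrow> b \<notin> X \<Longrightarrow> reach R X a b"
  unfolding reach_def by auto

lemma reach_step: "reach R X a b \<Longrightarrow> R b c \<Longrightarrow> b \<notin> X \<Longrightarrow> c \<notin> X \<Longrightarrow> reach R X a c"
  using reach_trans reach_edge by metis

lemma reach_sym:
  assumes "symp R" "reach R X a b" shows "reach R X b a"
proof -
  have "symp (\<lambda>a b. R a b \<and> a \<notin> X \<and> b \<notin> X)"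
    using assms(1) by (auto simp: symp_def)
  then show ?thesis
    using assms(2) unfolding reach_def by (meson symp_rtranclp sympD)
qed

lemma reach_notin: "reach R X a b \<Longrightarrow> a \<notin> X \<Longrightarrow> b \<notin> X"
  unfolding reach_def by (induction rule: rtranclp_induct) auto

lemma reach_closed:
  assumes "reach R X a b" "a \<in> U" and "\<And>c d. c \<in> U \<Longrightarrow> R c d \<Longrightarrow> c \<notin> X \<Longrightarrow> d \<notin> X \<Longrightarrow> d \<in> U"
  shows "b \<in> U"
  using assms(1) unfolding reach_def
  by (induction rule: rtranclp_induct) (use assms in auto)

text \<open>If the new endpoint already occurs on the path, the path is cut off there; otherwise the
  endpoint is appended.\<close>

lemma rtranclp_imp_distinct_path:
  assumes "Q\<^sup>*\<^sup>* a b"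
  shows "\<exists>p. p \<noteq> [] \<and> hd p = a \<and> last p = b \<and> distinct p \<and> successively Q p"
  using assms
proof (induction rule: rtranclp_induct)
  case base
  show ?case by (intro exI[of _ "[a]"]) auto
next
  case (step c b)
  then obtain p where p: "p \<noteq> []" "hd p = a" "last p = c" "distinct p" "successively Q p" by blast
  show ?case
  proof (cases "b \<in> set p")
    case True
    then obtain us vs where "p = us @ b # vs" by (meson split_list)
    moreover have "hd (us @ [b]) = hd p" using calculation by (cases us) auto
    ultimately show ?thesis using p
      by (intro exI[of _ "us @ [b]"]) (auto simp: successively_append_iff)
  next
    case False
    then show ?thesis using p step(2)
      by (intro exI[of _ "p @ [b]"]) (auto simp: successively_append_iff)
  qed
qed

lemma successively_imp_rtranclp:
  assumes "successively Q p" "u \<in> set p"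
  shows "Q\<^sup>*\<^sup>* (hd p) u"
  using assms
proof (induction p)
  case (Cons a p)
  then show ?case
    by (cases p) (auto intro: converse_rtranclp_into_rtranclp)
qed simp

lemma reach_imp_path:
  assumes "reach R X a b" "a \<notin> X"
  obtains p where "p \<noteq> []" "hd p = a" "last p = b" "distinct p" "successively R p"
    "set p \<inter> X = {}" "\<forall>u\<in>set p. reach R X a u"
proof -
  obtain p where p: "p \<noteq> []" "hd p = a" "last p = b" "distinct p"
    "successively (\<lambda>a b. R a b \<and> a \<notin> X \<and> b \<notin> X) p"
    using rtranclp_imp_distinct_path[OF assms(1)[unfolded reach_def]] by blast
  have r: "reach R X a u" if "u \<in> set p" for u
    using successively_imp_rtranclp[OF p(5) that] p(2) unfolding reach_def by simp
  show thesis
  proof (rule that)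
    show "successively R p" using p(5) by (rule successively_mono) auto
    show "set p \<inter> X = {}" using r reach_notin[OF _ assms(2)] by auto
  qed (use p r in auto)
qed

lemma path_imp_reach:
  assumes "successively R p" "set p \<inter> X = {}" "u \<in> set p"
  shows "reach R X (hd p) u"
  unfolding reach_def
proof (rule successively_imp_rtranclp)
  show "successively (\<lambda>a b. R a b \<and> a \<notin> X \<and> b \<notin> X) p"
    using assms(1,2) by (intro successively_mono[OF assms(1)]) auto
qed (rule assms(3))

section \<open>Cycles\<close>

text \<open>Every edge of a symmetric irreflexive relation gives a cycle of length 2 in this sense.
  With the bound 6 used below this does no harm, since only long cycles are excluded.\<close>

definition is_cycle :: "('a \<Rightarrow> 'a \<Rightarrow> bool) \<Rightarrow> 'a list \<Rightarrow> bool" where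
  "is_cycle R xs \<longleftrightarrow> xs \<noteq> [] \<and> distinct xs \<and> successively R xs \<and> R (last xs) (hd xs)"

definition cycles_below :: "nat \<Rightarrow> ('a \<Rightarrow> 'a \<Rightarrow> bool) \<Rightarrow> bool" where
  "cycles_below k R \<longleftrightarrow> (\<forall>xs. is_cycle R xs \<longrightarrow> length xs < k)"

lemma is_cycle_mono:
  assumes "is_cycle R xs" "\<And>a b. a \<in> set xs \<Longrightarrow> b \<in> set xs \<Longrightarrow> R a b \<Longrightarrow> Q a b"
  shows "is_cycle Q xs"
  using assms unfolding is_cycle_def
  by (metis successively_mono hd_in_set last_in_set)

lemma cycles_below_mono:
  assumes "cycles_below k R" "\<And>a b. Q a b \<Longrightarrow> R a b"
  shows "cycles_below k Q"
  using assms is_cycle_mono unfolding cycles_below_def by metis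

lemma is_cycle_rotate:
  assumes "is_cycle R (as @ y # bs)"
  shows "is_cycle R (y # bs @ as)"
proof -
  have "R (last (y # bs)) (hd as) \<and> R (last as) y" if "as \<noteq> []"
    using assms that by (auto simp: is_cycle_def successively_append_iff)
  then show ?thesis
    using assms
    by (cases "as = []"; cases "bs = []")
      (auto simp: is_cycle_def successively_append_iff successively_Cons)
qed

section \<open>Moving components from one cut vertex to another\<close>

text \<open>For symmetric \<open>R\<close>, such a \<open>U\<close> is a union of components of
  \<open>R\<close> minus \<open>x\<close>, linked to the rest only through \<open>x\<close>.\<close>

definition attached :: "('a \<Rightarrow> 'a \<Rightarrow> bool) \<Rightarrow> 'a \<Rightarrow> 'a set \<Rightarrow> bool" where
  "attached R x U \<longleftrightarrow> x \<notin> U \<and> (\<forall>a b. a \<in> U \<longrightarrow> R a b \<longrightarrow> b \<in> U \<or> b = x)"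

definition move :: "('a \<Rightarrow> 'a \<Rightarrow> bool) \<Rightarrow> 'a \<Rightarrow> 'a \<Rightarrow> 'a set \<Rightarrow> 'a \<Rightarrow> 'a \<Rightarrow> bool" where
  "move R x y U = (\<lambda>a b. (R a b \<and> \<not> (a = x \<and> b \<in> U) \<and> \<not> (b = x \<and> a \<in> U))
     \<or> (a = y \<and> b \<in> U \<and> R x b) \<or> (b = y \<and> a \<in> U \<and> R a x))"

lemma symp_move: "symp R \<Longrightarrow> symp (move R x y U)"
  by (auto simp: symp_def move_def)

lemma irreflp_move: "irreflp R \<Longrightarrow> y \<notin> U \<Longrightarrow> irreflp (move R x y U)"
  by (auto simp: irreflp_def move_def)

context
  fixes R :: "'a \<Rightarrow> 'a \<Rightarrow> bool" and x y :: 'a and U :: "'a set"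
  assumes sym: "symp R" and att: "attached R x U" and y: "y \<notin> U"
begin

lemma move_outside: "a \<notin> U \<Longrightarrow> b \<notin> U \<Longrightarrow> move R x y U a b = R a b"
  using att y by (auto simp: move_def attached_def)

lemma move_inside: "a \<in> U \<Longrightarrow> b \<in> U \<Longrightarrow> move R x y U a b = R a b"
  using att y by (auto simp: move_def attached_def)

lemma move_in_out: "a \<in> U \<Longrightarrow> b \<notin> U \<Longrightarrow> move R x y U a b \<longleftrightarrow> b = y \<and> R a x"
  using att y by (auto simp: move_def attached_def)

lemma move_out_in: "a \<notin> U \<Longrightarrow> b \<in> U \<Longrightarrow> move R x y U a b \<longleftrightarrow> a = y \<and> R x b"
  using att y sympD[OF sym] by (auto simp: move_def attached_def)

lemma attached_move: "attached (move R x y U) y U"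
  using att y by (auto simp: move_def attached_def)

text \<open>A cycle meets \<open>y\<close> at most once, and its other vertices lie all inside or
  all outside \<open>U\<close>. Outside \<open>U\<close> it is an old cycle; inside, replacing
  \<open>y\<close> by \<open>x\<close> gives an old cycle of the same length.\<close>

lemma cycles_below_move:
  assumes "cycles_below k R"
  shows "cycles_below k (move R x y U)"
  unfolding cycles_below_def
proof (intro allI impI)
  let ?R = "move R x y U"
  \<comment> \<open>Without \<open>y\<close>, no edge of the new graph crosses the boundary of
    \<open>U\<close>.\<close>
  have side: "set zs \<subseteq> U \<or> set zs \<inter> U = {}" if "successively ?R zs" "y \<notin> set zs" for zs
    using that
  proof (induction zs)
    case (Cons a zs)
    then show ?case
      using move_in_out[of a "hd zs"] move_out_in[of a "hd zs"] by (cases zs) auto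
  qed simp
  have short: "length zs < k" if "is_cycle ?R zs" "set zs \<subseteq> U \<or> set zs \<inter> U = {}" for zs
  proof -
    have "is_cycle R zs"
      using that(1)
    proof (rule is_cycle_mono)
      show "R a b" if "a \<in> set zs" "b \<in> set zs" "?R a b" for a b
        using that \<open>set zs \<subseteq> U \<or> set zs \<inter> U = {}\<close> move_inside[of a b] move_outside[of a b] by blast
    qed
    then show ?thesis using assms by (simp add: cycles_below_def)
  qed
  fix xs assume cyc: "is_cycle ?R xs"
  show "length xs < k"
  proof (cases "y \<in> set xs")
    case False
    then show ?thesis using side short cyc unfolding is_cycle_def by blast
  next
    case True
    then obtain as bs where xs: "xs = as @ y # bs" by (meson split_list)
    define zs where "zs = bs @ as"
    have c: "is_cycle ?R (y # zs)" and len: "length xs = length (y # zs)"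
      using is_cycle_rotate[of ?R as y bs] cyc xs by (auto simp: zs_def)
    then have zs: "y \<notin> set zs" "successively ?R zs" "distinct zs"
      by (auto simp: is_cycle_def successively_Cons)
    show ?thesis
    proof (cases "zs \<noteq> [] \<and> set zs \<subseteq> U")
      case False
      then have "set (y # zs) \<inter> U = {}" using side[OF zs(2,1)] y by auto
      then show ?thesis using short[OF c] len by simp
    next
      case True
      then have "successively R zs"
        using zs(2) by (intro successively_mono[OF zs(2)]) (use move_inside in blast)
      moreover have "?R y (hd zs)" "?R (last zs) y"
        using c True by (auto simp: is_cycle_def successively_Cons)
      then have "R x (hd zs)" "R (last zs) x"
        using True y move_out_in[of y "hd zs"] move_in_out[of "last zs" y]
        by (auto simp: subset_iff)
      ultimately have "is_cycle R (x # zs)"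
        using True zs att by (auto simp: is_cycle_def successively_Cons attached_def)
      then show ?thesis using assms len by (auto simp: cycles_below_def)
    qed
  qed
qed

end

text \<open>Rerouting loses nothing, because the edges now joining \<open>y\<close> to
  \<open>U\<close> are exactly the former ones at \<open>x\<close>.\<close>

lemma move_move:
  assumes "symp R" "attached R x U" "y \<notin> U"
  shows "move (move R x y U) y x U = R"
proof (intro ext)
  fix a b
  have x: "x \<notin> U" using assms(2) by (simp add: attached_def)
  note old = move_inside[OF assms] move_outside[OF assms] move_in_out[OF assms] move_out_in[OF assms]
  have 1: "symp (move R x y U)" "attached (move R x y U) y U"
    using assms by (auto intro: symp_move attached_move)
  note new = move_inside[OF 1 x] move_outside[OF 1 x] move_in_out[OF 1 x] move_out_in[OF 1 x]
  show "move (move R x y U) y x U a b = R a b"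
    using assms x sympD[OF assms(1)]
    by (cases "a \<in> U"; cases "b \<in> U") (auto simp: old new attached_def)
qed

definition comps :: "('a \<Rightarrow> 'a \<Rightarrow> bool) \<Rightarrow> 'a \<Rightarrow> 'a set \<Rightarrow> 'a set" where
  "comps R x Z = {u. u \<noteq> x \<and> (\<exists>z\<in>Z. reach R {x} z u)}"

lemma attached_comps: "attached R x (comps R x Z)"
  unfolding attached_def comps_def by (auto intro: reach_step)

lemma subset_comps: "x \<notin> Z \<Longrightarrow> Z \<subseteq> comps R x Z"
  unfolding comps_def using reach_refl by fast

text \<open>A walk that starts in \<open>U\<close> and avoids \<open>x\<close> cannot leave
  \<open>U\<close>, so it uses only edges inside \<open>U\<close>, and these survive in
  \<open>Q\<close>.\<close>

lemma reach_attached_transfer: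
  assumes "attached R x U" "z \<in> U" "reach R {x} z u"
    and "\<And>a b. a \<in> U \<Longrightarrow> b \<in> U \<Longrightarrow> R a b \<Longrightarrow> Q a b" "y \<notin> U"
  shows "u \<in> U \<and> reach Q {y} z u"
  using assms(3) unfolding reach_def
proof (induction rule: rtranclp_induct)
  case (step b c)
  then have "c \<in> U" using assms(1) by (auto simp: attached_def)
  then show ?case using step assms(4)[of b c] assms(5)
    by (auto intro!: rtranclp.rtrancl_into_rtrancl[of _ z b c])
qed (use assms in auto)

lemma reach_move:
  assumes "symp R" "attached R x U" "y \<notin> U" "z \<in> U"
  shows "reach (move R x y U) {y} z u \<longleftrightarrow> reach R {x} z u"
proof -
  have x: "x \<notin> U" using assms(2) by (simp add: attached_def)
  show ?thesis
    using reach_attached_transfer[OF assms(2,4), of u "move R x y U" y]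
      reach_attached_transfer[OF attached_move[OF assms(1-3)] assms(4), of u R x]
      move_inside[OF assms(1-3)] x assms(3) by blast
qed

text \<open>The moved set can be computed from the new graph, so a move can be undone knowing only
  \<open>x\<close>, \<open>y\<close> and \<open>Z\<close>.\<close>

lemma comps_move:
  assumes "symp R" "x \<notin> Z" "y \<notin> comps R x Z"
  shows "comps (move R x y (comps R x Z)) y Z = comps R x Z"
proof -
  let ?U = "comps R x Z"
  have Z: "Z \<subseteq> ?U" using assms(2) by (rule subset_comps)
  have "reach (move R x y ?U) {y} z u \<longleftrightarrow> reach R {x} z u" if "z \<in> Z" for z u
    using reach_move[OF assms(1) attached_comps assms(3)] Z that by blast
  moreover have "u \<noteq> x" "u \<noteq> y" if "z \<in> Z" "reach R {x} z u" for z u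
    using that assms(2,3) reach_notin[of R "{x}" z u] by (auto simp: comps_def)
  ultimately show ?thesis unfolding comps_def by blast
qed

section \<open>Stringing the components at a vertex into a chain\<close>

text \<open>Of the components still to be strung, that of \<open>y\<close> stays at \<open>x\<close>
  while those of \<open>ys\<close> are rehung from \<open>y\<close>, which becomes the next cut
  vertex.\<close>

fun chain :: "('a \<Rightarrow> 'a \<Rightarrow> bool) \<Rightarrow> 'a \<Rightarrow> 'a list \<Rightarrow> 'a \<Rightarrow> 'a \<Rightarrow> bool" where
  "chain R x [] = R"
| "chain R x (y # ys) = chain (move R x y (comps R x (set ys))) y ys"

text \<open>\<open>Y\<close> represents distinct components of \<open>R\<close> minus
  \<open>x\<close>. These may contain further neighbours of \<open>x\<close>, whose edges are
  rerouted along with the component.\<close>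

definition separated :: "('a \<Rightarrow> 'a \<Rightarrow> bool) \<Rightarrow> 'a \<Rightarrow> 'a set \<Rightarrow> bool" where
  "separated R x Y \<longleftrightarrow> (\<forall>y\<in>Y. R x y) \<and> (\<forall>y\<in>Y. \<forall>z\<in>Y. reach R {x} y z \<longrightarrow> y = z)"

context
  fixes R :: "'a \<Rightarrow> 'a \<Rightarrow> bool" and x y :: 'a and ys :: "'a list"
  assumes symR: "symp R" and irr: "irreflp R"
    and dist: "distinct (y # ys)" and sep: "separated R x (set (y # ys))"
begin

lemma hd_notin_comps: "y \<notin> (comps R x (set ys))"
  using dist sep by (auto simp: comps_def separated_def)

lemma root_notin: "x \<notin> set (y # ys)"
  using sep irr by (auto simp: separated_def irreflp_def)

lemma set_subset_comps: "set ys \<subseteq> (comps R x (set ys))"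
  using root_notin by (intro subset_comps) auto

text \<open>Passes the hypothesis of the recursion on from \<open>x\<close> to \<open>y\<close>:
  inside the moved set reachability does not change, by \<open>reach_move\<close>.\<close>

lemma separated_move: "separated (move R x y (comps R x (set ys))) y (set ys)"
  unfolding separated_def
proof (intro conjI ballI impI)
  fix z assume z: "z \<in> set ys"
  then have "z \<in> (comps R x (set ys))" using set_subset_comps by auto
  show "move R x y (comps R x (set ys)) y z"
    using z sep \<open>z \<in> (comps R x (set ys))\<close> by (auto simp: move_def separated_def)
  fix w assume w: "w \<in> set ys" "reach (move R x y (comps R x (set ys))) {y} z w"
  then show "z = w"
    using reach_move[OF symR attached_comps hd_notin_comps \<open>z \<in> (comps R x (set ys))\<close>] sep z
    by (auto simp: separated_def)
qed

lemma move_valid: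
  "symp (move R x y (comps R x (set ys)))" "irreflp (move R x y (comps R x (set ys)))"
  "comps (move R x y (comps R x (set ys))) y (set ys) = comps R x (set ys)"
  using symR irr hd_notin_comps root_notin
  by (auto intro: symp_move irreflp_move comps_move[THEN equalityD1, THEN subsetD]
      comps_move[THEN equalityD2, THEN subsetD])

end

lemma chain_props:
  assumes "symp R" "irreflp R" "distinct ys" "separated R x (set ys)"
  shows "symp (chain R x ys) \<and> irreflp (chain R x ys) \<and> (cycles_below k R \<longrightarrow> cycles_below k (chain R x ys))"
  using assms
proof (induction ys arbitrary: R x)
  case (Cons y ys)
  note c = Cons.prems
  show ?case
    using Cons.IH[of "move R x y (comps R x (set ys))" y]
      move_valid[OF c] separated_move[OF c] c(3) 
      cycles_below_move[OF c(1) attached_comps hd_notin_comps[OF c]] by auto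
qed simp

text \<open>Each move changes only edges with an end in its moved set, and all moved sets lie in
  \<open>comps R x (set ys)\<close>.\<close>

lemma chain_outside:
  assumes "symp R" "irreflp R" "distinct ys" "separated R x (set ys)"
    and "a \<notin> comps R x (set ys)" "b \<notin> comps R x (set ys)"
  shows "chain R x ys a b = R a b"
  using assms
proof (induction ys arbitrary: R x)
  case (Cons y ys)
  note c = Cons.prems(1-4)
  have "a \<notin> comps R x (set ys)" "b \<notin> comps R x (set ys)"
    using Cons.prems(5,6) by (auto simp: comps_def)
  then show ?case
    using Cons.IH[of "move R x y (comps R x (set ys))" y] c(3)
      move_valid[OF c] separated_move[OF c]
      move_outside[OF c(1) attached_comps hd_notin_comps[OF c]] by auto
qed simp

text \<open>By induction the rest of the chain hangs at \<open>y\<close> alone, which itself lies in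
  the larger set; edges that avoid the moved part are those of \<open>R\<close>.\<close>

lemma attached_chain:
  assumes "symp R" "irreflp R" "distinct ys" "separated R x (set ys)"
  shows "attached (chain R x ys) x (comps R x (set ys))"
  using assms
proof (induction ys arbitrary: R x)
  case (Cons y ys)
  note c = Cons.prems
  let ?U = "comps R x (set ys)" and ?V = "comps R x (set (y # ys))"
  let ?R = "move R x y ?U"
  have IH: "attached (chain ?R y ys) y ?U"
    using Cons.IH[of ?R y] move_valid[OF c] separated_move[OF c] c(3) by auto
  have sub: "?U \<subseteq> ?V" by (auto simp: comps_def)
  have y: "y \<in> ?V" using root_notin[OF c] by (auto simp: comps_def)
  show ?case unfolding attached_def
  proof (intro conjI allI impI)
    show "x \<notin> ?V" by (simp add: comps_def)
    fix a b assume a: "a \<in> ?V" and ab: "chain R x (y # ys) a b"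
    show "b \<in> ?V \<or> b = x"
    proof (cases "a \<in> ?U \<or> b \<in> ?U")
      case True
      then show ?thesis using IH ab sub y by (auto simp: attached_def)
    next
      case False
      then have "?R a b"
        using ab chain_outside[of ?R ys y a b] move_valid[OF c] separated_move[OF c] c(3) by auto
      then have "R a b"
        using move_outside[OF c(1) attached_comps hd_notin_comps[OF c]] False by auto
      then show ?thesis using a attached_comps[of R x "set (y # ys)"] by (auto simp: attached_def)
    qed
  qed
qed (simp add: attached_def comps_def)

text \<open>\<open>x\<close> and the head of the list lie outside the moved set, so their edge
  survives the first move and all later ones.\<close>

lemma chain_spine:
  assumes "symp R" "irreflp R" "distinct ys" "separated R x (set ys)"
  shows "successively (chain R x ys) (x # ys)"
  using assms
proof (induction ys arbitrary: R x)
  case (Cons y ys)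
  note c = Cons.prems
  let ?U = "comps R x (set ys)"
  let ?R = "move R x y ?U"
  have "x \<notin> ?U" by (simp add: comps_def)
  then have "chain ?R y ys x y = R x y"
    using chain_outside[of ?R ys y x y] move_valid[OF c] separated_move[OF c] c(3)
      hd_notin_comps[OF c] move_outside[OF c(1) attached_comps hd_notin_comps[OF c]] by auto
  then show ?case
    using Cons.IH[of ?R y] move_valid[OF c] separated_move[OF c] c by (auto simp: separated_def)
qed simp

text \<open>By \<open>attached_chain\<close> at \<open>y\<close>, the components of
  \<open>ys\<close> are linked to the rest only through \<open>y\<close>, so a walk from
  \<open>x\<close> avoiding \<open>y\<close> never enters them.\<close>

lemma chain_separates:
  assumes "symp R" "irreflp R" "distinct (y # ys)" "separated R x (set (y # ys))"
    and "reach (chain R x (y # ys)) {y} x z"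
  shows "z \<notin> set ys"
proof -
  note c = assms(1-4)
  let ?U = "comps R x (set ys)"
  let ?R = "move R x y ?U"
  have att: "attached (chain ?R y ys) y ?U"
    using attached_chain[of ?R ys y] move_valid[OF c] separated_move[OF c] c(3) by auto
  have "symp (chain ?R y ys)"
    using chain_props[of ?R ys y] move_valid[OF c] separated_move[OF c] c(3) by auto
  have "z \<in> - ?U"
    using assms(5)
  proof (rule reach_closed)
    show "x \<in> - ?U" by (simp add: comps_def)
    show "d \<in> - ?U" if "a \<in> - ?U" "chain R x (y # ys) a d" "a \<notin> {y}" "d \<notin> {y}" for a d
      using that att sympD[OF \<open>symp (chain ?R y ys)\<close>] by (auto simp: attached_def)
  qed
  then show ?thesis using set_subset_comps[OF c] by auto
qed

text \<open>The spine of the chain can be read off from its two ends: \<open>y\<close> is the only neighbour of \<open>x\<close>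
  that lies on every path from \<open>x\<close> to the far end.\<close>
lemma chain_inj:
  assumes "symp R" "irreflp R" "distinct ys" "separated R x (set ys)"
    and "symp Q" "irreflp Q" "distinct zs" "separated Q x (set zs)"
    and "chain R x ys = chain Q x zs" "ys \<noteq> []" "zs \<noteq> []" "last ys = last zs"
  shows "ys = zs \<and> R = Q"
  using assms
proof (induction ys arbitrary: R Q x zs)
  case (Cons y ys)
  obtain z zs' where zs: "zs = z # zs'" using Cons.prems(11) by (cases zs) auto
  note c = Cons.prems(1-4)
  note d = Cons.prems(5-8)[unfolded zs]
  let ?G = "chain R x (y # ys)"
  have G: "?G = chain Q x (z # zs')" using Cons.prems(9) zs by simp
  have e: "last (y # ys) = last (z # zs')" using Cons.prems(12) zs by simp
  have spine: "successively ?G (x # y # ys)" "successively ?G (x # z # zs')"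
    using chain_spine[OF c] chain_spine[OF d] G by auto
  have x: "x \<notin> set (y # ys)" "x \<notin> set (z # zs')" using root_notin[OF c] root_notin[OF d] by auto
  \<comment> \<open>Otherwise the spine of \<open>ys\<close> leads from \<open>x\<close> to the
    common far end without meeting \<open>z\<close>, although \<open>z\<close> separates the two in
    the second chain.\<close>
  have "z \<in> set (y # ys)"
  proof (rule ccontr)
    assume z: "z \<notin> set (y # ys)"
    then have "zs' \<noteq> []" using e last_in_set[of "y # ys"] by auto
    have "reach ?G {z} (hd (x # y # ys)) (last (y # ys))"
      using spine(1) z x by (intro path_imp_reach) auto
    then have "reach (chain Q x (z # zs')) {z} x (last zs')"
      using e \<open>zs' \<noteq> []\<close> by (simp only: G) simp
    from chain_separates[OF d this] show False using \<open>zs' \<noteq> []\<close> by simp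
  qed
  \<comment> \<open>\<open>z\<close> is adjacent to \<open>x\<close>, whereas vertices of
    \<open>ys\<close> cannot be reached from \<open>x\<close> without \<open>y\<close>.\<close>
  moreover have "z \<notin> set ys" if "z \<noteq> y"
  proof -
    have "?G x z" using spine(2) by simp
    then have "reach ?G {y} x z" using that x by (intro reach_edge) auto
    then show ?thesis by (rule chain_separates[OF c])
  qed
  ultimately have [simp]: "z = y" by auto
  let ?R = "move R x y (comps R x (set ys))" and ?Q = "move Q x y (comps Q x (set zs'))"
  have *: "ys = zs' \<and> ?R = ?Q"
  \<comment> \<open>If one list ends here, the common last vertex is \<open>y\<close>, and
    distinctness forces the other list to end too.\<close>
  proof (cases "ys = [] \<or> zs' = []")
    case True
    have "y \<notin> set ys" "y \<notin> set zs'" using c(3) d(3) by auto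
    then have "ys = []" "zs' = []"
      using True e last_in_set[of ys] last_in_set[of zs'] by (auto split: if_splits)
    then show ?thesis using G by simp
  next
    case False
    then show ?thesis
      using Cons.IH[of ?R y ?Q zs'] G e c(3) d(3) move_valid[OF c] separated_move[OF c]
        move_valid[OF d] separated_move[OF d] by auto
  qed
  \<comment> \<open>The first move is undone by one function of data that agree on both sides: the
    moved graph and the remaining list.\<close>
  define unmove where "unmove = (\<lambda>G us. move G y x (comps G y (set us)))"
  have "unmove ?R ys = R"
    using move_valid(3)[OF c] move_move[OF c(1) attached_comps hd_notin_comps[OF c]]
    by (simp add: unmove_def)
  moreover have "unmove ?Q zs' = Q"
    using move_valid(3)[OF d] move_move[OF d(1) attached_comps] hd_notin_comps[OF d]
    by (simp add: unmove_def)
  moreover have "unmove ?R ys = unmove ?Q zs'"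
    using * by (intro arg_cong2[where f = unmove]) blast+
  ultimately show ?case using * zs by simp
qed simp

lemma chain_field:
  assumes "\<And>a b. R a b \<Longrightarrow> a \<in> V \<and> b \<in> V" "set ys \<subseteq> V" "chain R x ys a b"
  shows "a \<in> V \<and> b \<in> V"
  using assms
proof (induction ys arbitrary: R x)
  case (Cons y ys)
  show ?case
    using Cons.prems(2,3)
    by (intro Cons.IH[of "move R x y (comps R x (set ys))" y]) (auto simp: move_def dest: Cons.prems(1))
qed auto

section \<open>Counting\<close>

text \<open>For \<open>k = 6\<close> and \<open>V = {1..n}\<close> these are the adjacency relations
  of the class, by \<open>bij_betw_adj\<close>.\<close>

definition graph_rels :: "'a set \<Rightarrow> nat \<Rightarrow> ('a \<Rightarrow> 'a \<Rightarrow> bool) set" where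
  "graph_rels V k = {R. symp R \<and> irreflp R \<and> (\<forall>a b. R a b \<longrightarrow> a \<in> V \<and> b \<in> V) \<and> cycles_below k R}"

lemma finite_graph_rels:
  assumes "finite V" shows "finite (graph_rels V k)"
proof (rule finite_subset)
  show "graph_rels V k \<subseteq> (\<lambda>S a b. (a, b) \<in> S) ` Pow (V \<times> V)"
  proof
    fix R assume "R \<in> graph_rels V k"
    then show "R \<in> (\<lambda>S a b. (a, b) \<in> S) ` Pow (V \<times> V)"
      by (intro image_eqI[of _ _ "{(a, b). R a b}"]) (auto simp: graph_rels_def)
  qed
qed (use assms in auto)

text \<open>Exactly \<open>m\<close> here amounts to at least \<open>m\<close> components, because
  subsets of separated sets are separated.\<close>

definition separated_pairs :: "'a set \<Rightarrow> nat \<Rightarrow> nat \<Rightarrow> (('a \<Rightarrow> 'a \<Rightarrow> bool) \<times> 'a) set" where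
  "separated_pairs V k m =
     {(R, v). R \<in> graph_rels V k \<and> v \<in> V \<and> (\<exists>Y. finite Y \<and> card Y = m \<and> separated R v Y)}"

lemma finite_separated_pairs: "finite V \<Longrightarrow> finite (separated_pairs V k m)"
  by (rule finite_subset[of _ "graph_rels V k \<times> V"])
     (auto simp: separated_pairs_def finite_graph_rels)

text \<open>Each pair admits at least \<open>m!\<close> orders \<open>ys\<close>, and by
  \<open>chain_inj\<close> a pair with an order is determined by the chain and its two ends.\<close>

lemma card_separated_pairs:
  assumes V: "finite V" and m: "m > 0"
  shows "card (separated_pairs V k m) * fact m \<le> card (graph_rels V k) * card V * card V"
proof -
  let ?P = "separated_pairs V k m" and ?G = "graph_rels V k"
  define L where "L = (\<lambda>(R, v). {ys. distinct ys \<and> length ys = m \<and> set ys \<subseteq> V \<and> separated R v (set ys)})"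
  have finL: "finite (L p)" for p
    by (rule finite_subset[OF _ finite_lists_length_eq[OF V, of m]]) (auto simp: L_def split: prod.splits)
  have big: "fact m \<le> card (L p)" if "p \<in> ?P" for p
  proof -
    obtain R v where p: "p = (R, v)" by (cases p)
    have "\<exists>Y. finite Y \<and> card Y = m \<and> separated R v Y" "R \<in> ?G"
      using that by (simp_all add: p separated_pairs_def)
    then obtain Y where Y: "finite Y" "card Y = m" "separated R v Y" "R \<in> ?G" by blast
    have "Y \<subseteq> V" using Y by (auto simp: separated_def graph_rels_def)
    then have "permutations_of_set Y \<subseteq> L p"
      using Y p by (auto simp: L_def permutations_of_set_def distinct_card)
    then show ?thesis
      using card_mono[OF finL[of p]] Y by (metis card_permutations_of_set)
  qed
  \<comment> \<open>\<open>m > 0\<close> makes \<open>ys\<close> nonempty, so that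
    \<open>last ys\<close> is a vertex of \<open>V\<close>.\<close>
  let ?f = "\<lambda>((R, v), ys). (chain R v ys, v, last ys)"
  have inj: "inj_on ?f (Sigma ?P L)"
  proof (rule inj_onI, clarsimp)
    fix R Q v ys zs
    assume a: "(R, v) \<in> ?P" "(Q, v) \<in> ?P" "ys \<in> L (R, v)" "zs \<in> L (Q, v)"
      "chain R v ys = chain Q v zs" "last ys = last zs"
    have "ys = zs \<and> R = Q"
      by (rule chain_inj[of R ys v Q zs])
         (use a m in \<open>auto simp: separated_pairs_def graph_rels_def L_def\<close>)
    then show "R = Q \<and> ys = zs" by auto
  qed
  have sub: "?f ` Sigma ?P L \<subseteq> ?G \<times> V \<times> V"
  proof clarsimp
    fix R v ys assume a: "(R, v) \<in> ?P" "ys \<in> L (R, v)"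
    then have R: "symp R" "irreflp R" "cycles_below k R" "distinct ys" "separated R v (set ys)"
        "\<And>a b. R a b \<Longrightarrow> a \<in> V \<and> b \<in> V" "set ys \<subseteq> V" "ys \<noteq> []" "v \<in> V"
      using m by (auto simp: separated_pairs_def graph_rels_def L_def)
    have "last ys \<in> V" using R(7,8) by auto
    then show "chain R v ys \<in> ?G \<and> v \<in> V \<and> last ys \<in> V"
      using chain_props[OF R(1,2,4,5), of k] R chain_field[of R V ys v, OF R(6,7)]
      unfolding graph_rels_def by blast
  qed
  have "card ?P * fact m = (\<Sum>p\<in>?P. fact m)" by simp
  also have "\<dots> \<le> (\<Sum>p\<in>?P. card (L p))" by (intro sum_mono big)
  also have "\<dots> = card (Sigma ?P L)"
    using finL finite_separated_pairs[OF V] by (intro card_SigmaI[symmetric]) auto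
  also have "\<dots> = card (?f ` Sigma ?P L)" using card_image[OF inj] by simp
  also have "\<dots> \<le> card (?G \<times> V \<times> V)"
    using V by (intro card_mono sub finite_cartesian_product finite_graph_rels)
  finally show ?thesis by (simp add: card_cartesian_product mult.assoc)
qed

section \<open>Hubs\<close>

text \<open>The component of \<open>w\<close> in \<open>R\<close> minus \<open>v\<close> and
  \<open>t\<close> is linked to these two only through \<open>w\<close>; once the edge from
  \<open>t\<close> to \<open>w\<close> is cut, it can hang only at \<open>v\<close>.\<close>

definition isolated :: "('a \<Rightarrow> 'a \<Rightarrow> bool) \<Rightarrow> 'a \<Rightarrow> 'a \<Rightarrow> 'a \<Rightarrow> bool" where
  "isolated R v t w \<longleftrightarrow> (\<forall>y. R v y \<or> R t y \<longrightarrow> reach R {v, t} w y \<longrightarrow> y = w)"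

context
  fixes R :: "'a \<Rightarrow> 'a \<Rightarrow> bool" and v :: 'a
  assumes symR: "symp R" and irr: "irreflp R" and cyc: "cycles_below 6 R"
begin

text \<open>Closing the path through \<open>v\<close> gives a cycle of length
  \<open>length p + 1\<close>.\<close>

lemma path_between_neighbours:
  assumes "p \<noteq> []" "distinct p" "successively R p" "v \<notin> set p" "R v (hd p)" "R v (last p)"
  shows "length p < 5"
proof -
  have "is_cycle R (v # p)"
    using assms sympD[OF symR] by (auto simp: is_cycle_def successively_Cons)
  then show ?thesis using cyc by (auto simp: cycles_below_def)
qed

text \<open>By \<open>path_between_neighbours\<close>, each vertex of \<open>S\<close> is reached
  from \<open>y\<close> by a path on at most four vertices. Sorting by the number of steps gives
  \<open>y\<close> itself and three sets with common neighbours \<open>y\<close>, \<open>t2\<close>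
  and \<open>t3\<close>; the best of these serves as \<open>t\<close>.\<close>

lemma exists_hub:
  assumes y: "R v y" and S: "S = {u. R v u \<and> reach R {v} y u}" "finite S"
  shows "\<exists>t. t \<noteq> v \<and> card S \<le> 3 * card {w \<in> S. R t w} + 1"
proof -
  note sym = sympD[OF symR]
  have irrD: "\<not> R a a" for a using irr by (simp add: irreflp_def)
  have long: False if "distinct p" "successively R p" "v \<notin> set p" "length p \<ge> 5" "R v (hd p)" "R v (last p)" for p
    using path_between_neighbours[of p] that by force
  define S1 where "S1 = {w \<in> S. R y w}"
  define S2 where "S2 = {w \<in> S - S1 - {y}. \<exists>x. x \<noteq> v \<and> R y x \<and> R x w}"
  define S3 where "S3 = {w \<in> S - S1 - S2 - {y}. \<exists>x z. x \<noteq> v \<and> z \<noteq> v \<and> R y x \<and> R x z \<and> R z w}"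
  have yv: "y \<noteq> v" using y irrD by auto
  have SS: "R v w" "w \<noteq> v" if "w \<in> S" for w using that S(1) irrD by auto
  have cover: "S \<subseteq> {y} \<union> S1 \<union> S2 \<union> S3"
  proof
    fix w assume w: "w \<in> S"
    then have "reach R {v} y w" "y \<notin> {v}" using S(1) yv by auto
    then obtain p where p: "p \<noteq> []" "hd p = y" "last p = w" "distinct p" "successively R p" "set p \<inter> {v} = {}"
      by (rule reach_imp_path)
    have "length p < 5"
      using p y SS[OF w] by (intro path_between_neighbours) auto
    moreover have "length p \<noteq> 0" using p(1) by simp
    ultimately consider "length p = 1" | "length p = 2" | "length p = 3" | "length p = 4" by linarith
    then show "w \<in> {y} \<union> S1 \<union> S2 \<union> S3"
    proof cases
      case 1
      then have "p = [y]" using p(2) by (auto simp: length_Suc_conv)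
      then show ?thesis using p by simp
    next
      case 2
      then have "p = [y, w]" using p(2,3) by (auto simp: length_Suc_conv numeral_2_eq_2)
      then show ?thesis using p w by (auto simp: S1_def)
    next
      case 3
      then obtain x where "p = [y, x, w]" using p(2,3) by (auto simp: length_Suc_conv numeral_3_eq_3)
      then have "R y x" "R x w" "x \<noteq> v" using p by auto
      then show ?thesis using w unfolding S2_def by blast
    next
      case 4
      then obtain x z where "p = [y, x, z, w]"
        using p(2,3) by (auto simp: length_Suc_conv eval_nat_numeral)
      then have "R y x" "R x z" "R z w" "x \<noteq> v" "z \<noteq> v" using p by auto
      then show ?thesis using w unfolding S3_def by blast
    qed
  qed
  have "\<exists>t. t \<noteq> v \<and> S2 \<subseteq> {w \<in> S. R t w}"
  proof (cases "S2 = {}")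
    case False
    then obtain w1 x1 where 1: "w1 \<in> S2" "x1 \<noteq> v" "R y x1" "R x1 w1" by (auto simp: S2_def)
    \<comment> \<open>Otherwise \<open>w1, x1, y, x, w\<close> is a path on five vertices between
      neighbours of \<open>v\<close>.\<close>
    have "R x1 w" if w: "w \<in> S2" for w
    proof (rule ccontr)
      assume n: "\<not> R x1 w"
      obtain x where x: "x \<noteq> v" "R y x" "R x w" using w by (auto simp: S2_def)
      show False
        by (rule long[of "[w1, x1, y, x, w]"])
           (use n 1 x w yv SS irrD in \<open>auto simp: S2_def S1_def intro: sym\<close>)
    qed
    then show ?thesis using 1(2) by (intro exI[of _ x1]) (auto simp: S2_def)
  qed (use yv in auto)
  then obtain t2 where t2: "t2 \<noteq> v" "S2 \<subseteq> {w \<in> S. R t2 w}" by blast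
  have "\<exists>t. t \<noteq> v \<and> S3 \<subseteq> {w \<in> S. R t w}"
  proof (cases "S3 = {}")
    case False
    then obtain w1 where "w1 \<in> S3" by blast
    then obtain x1 z1 where 1: "w1 \<in> S3" "x1 \<noteq> v" "z1 \<noteq> v" "R y x1" "R x1 z1" "R z1 w1"
      by (auto simp: S3_def)
    have far: "\<not> R y w" "w \<in> S" "w \<noteq> y" "\<And>x. x \<noteq> v \<Longrightarrow> R y x \<Longrightarrow> \<not> R x w" if "w \<in> S3" for w
      using that by (auto simp: S3_def S2_def S1_def)
    \<comment> \<open>If both routes leave \<open>y\<close> through the same vertex, the path turns
      there and has five vertices; otherwise it runs through \<open>y\<close> and has seven.\<close>
    have "R z1 w" if w: "w \<in> S3" for w
    proof (rule ccontr)
      assume n: "\<not> R z1 w"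
      obtain x z where x: "x \<noteq> v" "z \<noteq> v" "R y x" "R x z" "R z w" using w by (auto simp: S3_def)
      have z: "z \<noteq> y" "\<not> R y z" "z1 \<noteq> y" "\<not> R y z1"
        using far[OF w] far[OF 1(1)] x 1 by auto
      have ne: "w \<noteq> w1" "z \<noteq> z1" using n 1 x by auto
      have ne2: "w \<noteq> z" "w \<noteq> z1" "w \<noteq> x" "w \<noteq> x1" "w1 \<noteq> z" "w1 \<noteq> z1" "w1 \<noteq> x" "w1 \<noteq> x1"
        "z \<noteq> x" "z \<noteq> x1" "z1 \<noteq> x" "z1 \<noteq> x1" "x \<noteq> y" "x1 \<noteq> y" "w \<noteq> y" "w1 \<noteq> y"
        using far[OF w] far[OF 1(1)] x 1 z irrD by metis+
      have vv: "R v w" "R v w1" "w \<noteq> v" "w1 \<noteq> v" using SS far[OF w] far[OF 1(1)] by auto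
      show False
      proof (cases "x = x1")
        case True
        show False
          by (rule long[of "[w1, z1, x1, z, w]"]) (use True 1 x ne ne2 vv in \<open>auto intro: sym\<close>)
      next
        case False
        show False
          by (rule long[of "[w1, z1, x1, y, x, z, w]"])
             (use False 1 x z ne ne2 vv yv in \<open>auto intro: sym\<close>)
      qed
    qed
    then show ?thesis using 1(3) far(2) by (intro exI[of _ z1]) auto
  qed (use yv in auto)
  then obtain t3 where t3: "t3 \<noteq> v" "S3 \<subseteq> {w \<in> S. R t3 w}" by blast
  have fin: "finite {w \<in> S. R t w}" for t using S(2) by auto
  have "finite S1" "finite S2" "finite S3" using S(2) by (auto simp: S1_def S2_def S3_def)
  have "card S \<le> card ({y} \<union> S1 \<union> S2 \<union> S3)"
    using cover \<open>finite S1\<close> \<open>finite S2\<close> \<open>finite S3\<close> by (intro card_mono) auto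
  also have "\<dots> \<le> 1 + card S1 + card S2 + card S3"
    using card_Un_le[of "{y} \<union> S1 \<union> S2" S3] card_Un_le[of "{y} \<union> S1" S2] card_Un_le[of "{y}" S1]
    by simp
  also have "\<dots> \<le> 1 + card {w \<in> S. R y w} + card {w \<in> S. R t2 w} + card {w \<in> S. R t3 w}"
    using card_mono[OF fin t2(2)] card_mono[OF fin t3(2)] by (simp add: S1_def)
  finally have "card S \<le> 3 * card {w \<in> S. R y w} + 1 \<or> card S \<le> 3 * card {w \<in> S. R t2 w} + 1
     \<or> card S \<le> 3 * card {w \<in> S. R t3 w} + 1" by linarith
  then show ?thesis using yv t2(1) t3(1) by blast
qed

text \<open>A component of \<open>R\<close> minus \<open>v\<close> and \<open>t\<close> contains at
  most two vertices of \<open>L\<close> (\<open>no3\<close>), and all vertices of \<open>L\<close>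
  that are not isolated share one component (\<open>same\<close>).\<close>

lemma card_not_isolated:
  assumes t: "t \<noteq> v" and L: "\<And>w. w \<in> L \<Longrightarrow> R v w \<and> R t w" "finite L" "card L \<ge> 5"
  shows "card {w \<in> L. \<not> isolated R v t w} \<le> 2"
proof -
  note sym = sympD[OF symR]
  have irrD: "\<not> R a a" for a using irr by (simp add: irreflp_def)
  have Lv: "w \<noteq> v" "w \<noteq> t" if "w \<in> L" for w using L(1)[OF that] irrD by auto
  \<comment> \<open>A path on three or four vertices misses some \<open>w\<close> in
    \<open>L\<close>, as \<open>card L >= 5\<close>; extended by \<open>t\<close> and
    \<open>w\<close> it has at least five vertices.\<close>
  have two: "length p \<le> 2"
    if "p \<noteq> []" "distinct p" "successively R p" "set p \<inter> {v, t} = {}" "hd p \<in> L" "last p \<in> L" for p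
  proof (rule ccontr)
    assume "\<not> length p \<le> 2"
    have "length p < 5" using that L(1) by (intro path_between_neighbours) auto
    then have "card (set p) < card L" using L(3) distinct_card[OF that(2)] by simp
    then obtain w where w: "w \<in> L" "w \<notin> set p"
      using card_mono[of "set p" L] by (auto simp: not_le[symmetric])
    have "length (p @ [t, w]) < 5"
      using that w Lv[OF w(1)] L(1)[OF w(1)] L(1)[OF that(5)] L(1)[OF that(6)] t
      by (intro path_between_neighbours) (auto simp: successively_append_iff intro: sym)
    then show False using \<open>\<not> length p \<le> 2\<close> by simp
  qed
  have adj: "R w w'" if "w \<in> L" "w' \<in> L" "w \<noteq> w'" "reach R {v, t} w w'" for w w'
  proof -
    have "w \<notin> {v, t}" using Lv that by auto
    with that(4) obtain p where p: "p \<noteq> []" "hd p = w" "last p = w'" "distinct p" "successively R p"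
      "set p \<inter> {v, t} = {}" by (rule reach_imp_path)
    have "length p \<le> 2" using p that by (intro two) auto
    moreover have "length p \<noteq> 0" using p(1) by simp
    moreover have "length p \<noteq> 1" using p(2,3) that(3) by (auto simp: length_Suc_conv)
    ultimately have "length p = 2" by linarith
    then have "p = [w, w']" using p(2,3) by (auto simp: length_Suc_conv numeral_2_eq_2)
    then show ?thesis using p(5) by simp
  qed
  have no3: False
    if "w1 \<in> L" "w2 \<in> L" "w3 \<in> L" "w1 \<noteq> w2" "w1 \<noteq> w3" "w2 \<noteq> w3"
      "reach R {v, t} w1 w2" "reach R {v, t} w1 w3" for w1 w2 w3
  proof -
    have "reach R {v, t} w2 w3" using that(7,8) reach_sym[OF symR] reach_trans by metis
    then have "R w1 w2" "R w2 w3" using adj that by auto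
    then have "length [w1, w2, w3] \<le> 2" using that Lv by (intro two) auto
    then show False by simp
  qed
  \<comment> \<open>The witness \<open>y\<close> against isolation is adjacent to \<open>v\<close>
    or \<open>t\<close>, and \<open>w\<close> to both, so the path between them can be oriented to
    start next to \<open>v\<close> and end next to \<open>t\<close>.\<close>
  have arm: "\<exists>q. length q \<ge> 2 \<and> distinct q \<and> successively R q \<and> set q \<inter> {v, t} = {} \<and>
      R v (hd q) \<and> R (last q) t \<and> (\<forall>u\<in>set q. reach R {v, t} w u)"
    if w: "w \<in> L" "\<not> isolated R v t w" for w
  proof -
    obtain y where y: "R v y \<or> R t y" "reach R {v, t} w y" "y \<noteq> w" using w(2) by (auto simp: isolated_def)
    have "w \<notin> {v, t}" using Lv w(1) by auto
    with y(2) obtain p where p: "p \<noteq> []" "hd p = w" "last p = y" "distinct p" "successively R p"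
      "set p \<inter> {v, t} = {}" "\<forall>u\<in>set p. reach R {v, t} w u" by (rule reach_imp_path)
    have len: "length p \<ge> 2" using p(1-3) y(3) by (cases p; cases "tl p") auto
    have rev: "successively R (rev p)"
      using p(5) sym by (subst successively_rev) (auto elim: successively_mono)
    show ?thesis
    proof (cases "R v y")
      case True
      then show ?thesis using p len rev L(1)[OF w(1)]
        by (intro exI[of _ "rev p"]) (auto simp: hd_rev last_rev intro: sym)
    next
      case False
      then show ?thesis using p len y(1) L(1)[OF w(1)]
        by (intro exI[of _ p]) (auto intro: sym)
    qed
  qed
  \<comment> \<open>Arms in different components are disjoint; joined through \<open>t\<close> they
    form a path on at least five vertices.\<close>
  have same: "reach R {v, t} w1 w2"
    if w: "w1 \<in> L" "\<not> isolated R v t w1" "w2 \<in> L" "\<not> isolated R v t w2" for w1 w2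
  proof (rule ccontr)
    assume n: "\<not> reach R {v, t} w1 w2"
    obtain q1 where q1: "length q1 \<ge> 2" "distinct q1" "successively R q1" "set q1 \<inter> {v, t} = {}"
      "R v (hd q1)" "R (last q1) t" "\<And>u. u \<in> set q1 \<Longrightarrow> reach R {v, t} w1 u"
      using arm[OF w(1,2)] by blast
    obtain q2 where q2: "length q2 \<ge> 2" "distinct q2" "successively R q2" "set q2 \<inter> {v, t} = {}"
      "R v (hd q2)" "R (last q2) t" "\<And>u. u \<in> set q2 \<Longrightarrow> reach R {v, t} w2 u"
      using arm[OF w(3,4)] by blast
    have disj: "set q1 \<inter> set q2 = {}"
      using n q1(7) q2(7) reach_sym[OF symR] reach_trans by (metis disjoint_iff)
    have rev: "successively R (rev q2)"
      using q2(3) sym by (subst successively_rev) (auto elim: successively_mono)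
    have ne: "q1 \<noteq> []" "q2 \<noteq> []" using q1(1) q2(1) by auto
    have "length (q1 @ t # rev q2) < 5"
    proof (rule path_between_neighbours)
      show "successively R (q1 @ t # rev q2)"
        using q1 q2 rev ne by (auto simp: successively_append_iff successively_Cons hd_rev intro: sym)
      show "R v (last (q1 @ t # rev q2))" using ne q2(5) by (simp add: last_rev)
    qed (use q1 q2 disj t ne in auto)
    then show False using q1(1) q2(1) by simp
  qed
  show ?thesis
  proof (rule ccontr)
    assume "\<not> ?thesis"
    then have "3 \<le> card {w \<in> L. \<not> isolated R v t w}" by simp
    then obtain B where B: "B \<subseteq> {w \<in> L. \<not> isolated R v t w}" "card B = 3"
      by (meson obtain_subset_with_card_n)
    then obtain w1 w2 w3 where "B = {w1, w2, w3}" "w1 \<noteq> w2" "w1 \<noteq> w3" "w2 \<noteq> w3"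
      by (auto simp: card_3_iff)
    then show False using B(1) no3[of w1 w2 w3] same[of w1 w2] same[of w1 w3] by auto
  qed
qed

text \<open>\<open>D\<close> holds vertices to be cut off from the hub \<open>t\<close>; the pair
  \<open>A\<close> keeps its edges so that \<open>t\<close> can be identified afterwards. At most
  two non-isolated vertices and the pair are lost, so
  \<open>card S <= 3 * (card D + 4) + 1\<close>.\<close>

lemma local_structure:
  assumes y: "R v y" and S: "S = {u. R v u \<and> reach R {v} y u}" "finite S"
  shows "\<exists>t A D. A \<subseteq> S \<and> D \<subseteq> S \<and> A \<inter> D = {} \<and> card S \<le> 3 * card D + 15 \<and> t \<noteq> v \<and>
    (D \<noteq> {} \<longrightarrow> card A = 2) \<and> (\<forall>w\<in>A \<union> D. R t w \<and> isolated R v t w)"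
\<comment> \<open>Beyond 15, \<open>exists_hub\<close> provides the five common neighbours that
  \<open>card_not_isolated\<close> requires.\<close>
proof (cases "card S \<le> 15")
  case True
  moreover have "y \<noteq> v" using y irr by (auto simp: irreflp_def)
  ultimately show ?thesis by (intro exI[of _ y] exI[of _ "{}"]) auto
next
  case False
  obtain t where t: "t \<noteq> v" "card S \<le> 3 * card {w \<in> S. R t w} + 1"
    using exists_hub[OF assms] by blast
  define L where "L = {w \<in> S. R t w}"
  define B where "B = {w \<in> L. \<not> isolated R v t w}"
  have fin: "finite L" using S(2) by (simp add: L_def)
  have L: "card L \<ge> 5" "card S \<le> 3 * card L + 1" using t(2) False by (auto simp: L_def)
  have "card B \<le> 2"
    unfolding B_def by (rule card_not_isolated[OF t(1) _ fin L(1)]) (auto simp: L_def S(1))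
  then have good: "card (L - B) \<ge> card L - 2"
    using fin by (subst card_Diff_subset) (auto simp: B_def)
  then have "2 \<le> card (L - B)" using L(1) by linarith
  then obtain A where A: "A \<subseteq> L - B" "card A = 2" by (meson obtain_subset_with_card_n)
  define D where "D = L - B - A"
  have "card D = card (L - B) - 2"
    using A fin by (simp add: D_def card_Diff_subset finite_subset[OF A(1)])
  then have "card S \<le> 3 * card D + 15" using good L by linarith
  then show ?thesis using A t(1)
    by (intro exI[of _ t] exI[of _ A] exI[of _ D]) (auto simp: D_def B_def L_def)
qed

end

section \<open>Cutting neighbours of a vertex off from their hubs\<close>

definition cut_edges :: "('a \<Rightarrow> 'a \<Rightarrow> bool) \<Rightarrow> 'a set \<Rightarrow> ('a \<Rightarrow> 'a) \<Rightarrow> 'a \<Rightarrow> 'a \<Rightarrow> bool" where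
  "cut_edges R D h = (\<lambda>a b. R a b \<and> \<not> (b \<in> D \<and> a = h b) \<and> \<not> (a \<in> D \<and> b = h a))"

definition add_edges :: "('a \<Rightarrow> 'a \<Rightarrow> bool) \<Rightarrow> 'a set \<Rightarrow> ('a \<Rightarrow> 'a) \<Rightarrow> 'a \<Rightarrow> 'a \<Rightarrow> bool" where
  "add_edges R D h = (\<lambda>a b. R a b \<or> (b \<in> D \<and> a = h b) \<or> (a \<in> D \<and> b = h a))"

text \<open>With \<open>A\<close> the union of the reserved pairs, this finds the hubs in the graph
  after the cut.\<close>

definition hubs :: "('a \<Rightarrow> 'a \<Rightarrow> bool) \<Rightarrow> 'a \<Rightarrow> 'a set \<Rightarrow> 'a set" where
  "hubs R v A = {u. u \<noteq> v \<and> (\<exists>a\<in>A. \<exists>b\<in>A. a \<noteq> b \<and> R u a \<and> R u b)}"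

lemma separated_subset: "separated R v Y \<Longrightarrow> Z \<subseteq> Y \<Longrightarrow> separated R v Z"
  by (auto simp: separated_def subset_iff)

text \<open>Fewer than \<open>m\<close> components of \<open>R\<close> minus \<open>v\<close>
  contain neighbours of \<open>v\<close>. Summing \<open>local_structure\<close> over them loses
  less than \<open>15 * m\<close>, so at least \<open>k\<close> vertices can be cut off.\<close>

lemma global_structure:
  fixes R :: "'a \<Rightarrow> 'a \<Rightarrow> bool"
  assumes symR: "symp R" and irr: "irreflp R" and cyc: "cycles_below 6 R"
    and fin: "finite {u. R v u}" and deg: "3 * k + 15 * m \<le> card {u. R v u}"
    and few: "\<not> (\<exists>Y. finite Y \<and> card Y = m \<and> separated R v Y)"
  shows "\<exists>A D h. A \<subseteq> {u. R v u} \<and> D \<subseteq> {u. R v u} \<and> card D = k \<and>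
    (\<forall>w\<in>D. h w \<noteq> v \<and> R (h w) w) \<and> separated (cut_edges R D h) v D \<and>
    h ` D \<subseteq> hubs (cut_edges R D h) v A \<and> finite (hubs (cut_edges R D h) v A) \<and>
    card (hubs (cut_edges R D h) v A) \<le> m"
proof -
  note sym = sympD[OF symR]
  have irrD: "\<not> R a a" for a using irr by (simp add: irreflp_def)
  let ?N = "{u. R v u}"
  define F where "F = {Y. separated R v Y}"
  have F: "Y \<subseteq> ?N" "finite Y" if "Y \<in> F" for Y
    using that finite_subset[OF _ fin] by (auto simp: F_def separated_def)
  have "finite F" by (rule finite_subset[of _ "Pow ?N"]) (use F fin in auto)
  moreover have "{} \<in> F" by (simp add: F_def separated_def)
  \<comment> \<open>By maximality \<open>Y\<close> has a vertex in every component that contains a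
    neighbour of \<open>v\<close>.\<close>
  ultimately obtain Y where Y: "Y \<in> F" "\<And>Z. Z \<in> F \<Longrightarrow> Y \<subseteq> Z \<Longrightarrow> Y = Z"
    using finite_has_maximal[of F] by auto
  have YN: "Y \<subseteq> ?N" "finite Y" and sepY: "separated R v Y" using Y(1) F by (auto simp: F_def)
  have cardY: "card Y < m"
  proof (rule ccontr)
    assume "\<not> card Y < m"
    then have "m \<le> card Y" by simp
    then obtain Z where "Z \<subseteq> Y" "card Z = m" by (meson obtain_subset_with_card_n)
    then show False using few YN(2) separated_subset[OF sepY] finite_subset by metis
  qed
  define S where "S = (\<lambda>y. {u. R v u \<and> reach R {v} y u})"
  have finS: "finite (S y)" for y using fin by (simp add: S_def)
  have cover: "?N \<subseteq> (\<Union>y\<in>Y. S y)"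
  proof
    fix u assume u: "u \<in> ?N"
    show "u \<in> (\<Union>y\<in>Y. S y)"
    proof (rule ccontr)
      assume n: "u \<notin> (\<Union>y\<in>Y. S y)"
      then have "\<not> reach R {v} y u" "\<not> reach R {v} u y" if "y \<in> Y" for y
        using u that reach_sym[OF symR] by (auto simp: S_def)
      then have "separated R v (insert u Y)"
        using sepY u unfolding separated_def by blast
      then have "u \<in> Y" using Y(2)[of "insert u Y"] by (auto simp: F_def)
      then show False using n u by (auto simp: S_def)
    qed
  qed
  have uniq: "y = y'" if "y \<in> Y" "y' \<in> Y" "u \<in> S y" "u' \<in> S y'" "reach R {v} u u'" for y y' u u'
  proof -
    have "reach R {v} y u" "reach R {v} u' y'"
      using that reach_sym[OF symR] by (auto simp: S_def)
    then have "reach R {v} y y'" using that(5) reach_trans by metis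
    then show ?thesis using sepY that(1,2) by (auto simp: separated_def)
  qed
  have "\<forall>y\<in>Y. \<exists>t A D. A \<subseteq> S y \<and> D \<subseteq> S y \<and> A \<inter> D = {} \<and> card (S y) \<le> 3 * card D + 15 \<and> t \<noteq> v \<and>
    (D \<noteq> {} \<longrightarrow> card A = 2) \<and> (\<forall>w\<in>A \<union> D. R t w \<and> isolated R v t w)"
    using local_structure[OF symR irr cyc, of v _ "S _"] YN finS unfolding S_def by blast
  then obtain t A' D' where loc: "\<forall>y\<in>Y. A' y \<subseteq> S y \<and> D' y \<subseteq> S y \<and> A' y \<inter> D' y = {} \<and>
      card (S y) \<le> 3 * card (D' y) + 15 \<and> t y \<noteq> v \<and>
      (D' y \<noteq> {} \<longrightarrow> card (A' y) = 2) \<and> (\<forall>w\<in>A' y \<union> D' y. R (t y) w \<and> isolated R v (t y) w)"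
    by metis
  have loc1: "A' y \<subseteq> S y" "D' y \<subseteq> S y" "A' y \<inter> D' y = {}" "card (S y) \<le> 3 * card (D' y) + 15"
      "t y \<noteq> v" "D' y \<noteq> {} \<Longrightarrow> card (A' y) = 2" "\<And>w. w \<in> A' y \<union> D' y \<Longrightarrow> R (t y) w"
      "\<And>w. w \<in> A' y \<union> D' y \<Longrightarrow> isolated R v (t y) w" if "y \<in> Y" for y
    using bspec[OF loc that] by blast+
  define A where "A = (\<Union>y\<in>Y. A' y)"
  have disjD: "D' y \<inter> D' y' = {}" if y: "y \<in> Y" "y' \<in> Y" "y \<noteq> y'" for y y'
  proof (rule ccontr)
    assume "D' y \<inter> D' y' \<noteq> {}"
    then obtain u where "u \<in> S y" "u \<in> S y'" using loc1(2) y(1,2) by blast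
    then show False using uniq[OF y(1,2), of u u] y(3) by simp
  qed
  have "card ?N \<le> card (\<Union>y\<in>Y. S y)" using cover finS YN(2) by (intro card_mono) auto
  also have "\<dots> \<le> (\<Sum>y\<in>Y. card (S y))" using YN(2) by (rule card_UN_le)
  also have "\<dots> \<le> (\<Sum>y\<in>Y. 3 * card (D' y) + 15)" using loc1(4) by (intro sum_mono)
  also have "\<dots> = 3 * (\<Sum>y\<in>Y. card (D' y)) + 15 * card Y"
    by (simp add: sum.distrib sum_distrib_left)
  also have "(\<Sum>y\<in>Y. card (D' y)) = card (\<Union>y\<in>Y. D' y)"
    using YN(2) disjD finite_subset[OF loc1(2) finS] by (intro card_UN_disjoint[symmetric]) auto
  finally have "k \<le> card (\<Union>y\<in>Y. D' y)" using deg cardY by linarith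
  then obtain D where D: "D \<subseteq> (\<Union>y\<in>Y. D' y)" "card D = k"
    by (meson obtain_subset_with_card_n)
  have "\<forall>w\<in>D. \<exists>y. y \<in> Y \<and> w \<in> D' y" using D(1) by blast
  then obtain r where r: "\<And>w. w \<in> D \<Longrightarrow> r w \<in> Y" "\<And>w. w \<in> D \<Longrightarrow> w \<in> D' (r w)" by metis
  define h where "h = (\<lambda>w. t (r w))"
  let ?Q = "cut_edges R D h"
  have rS: "w \<in> S (r w)" if "w \<in> D" for w using r[OF that] loc1(2) by blast
  have DN: "D \<subseteq> ?N" using rS by (auto simp: S_def)
  have AN: "A \<subseteq> ?N" using loc1(1) by (auto simp: A_def S_def)
  have hD: "h w \<noteq> v" "R (h w) w" "isolated R v (h w) w" if "w \<in> D" for w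
    using r[OF that] loc1(5,7,8) by (auto simp: h_def)
  \<comment> \<open>A step into the hub would come from a neighbour of the hub reachable from
    \<open>w\<close>; isolation makes it \<open>w\<close> itself, whose edge to the hub has been
    cut.\<close>
  have inR: "reach R {v, h w} w u" if w: "w \<in> D" and u: "reach ?Q {v} w u" for w u
  proof -
    have wn: "w \<noteq> v" "w \<noteq> h w" using w hD[OF w] DN irrD by auto
    have "u \<noteq> h w \<and> reach R {v, h w} w u"
      using u unfolding reach_def[of ?Q]
    proof (induction rule: rtranclp_induct)
      case (step b c)
      have bc: "?Q b c" "b \<noteq> v" "c \<noteq> v" "R b c" using step(2) by (auto simp: cut_edges_def)
      have "c \<noteq> h w"
      proof
        assume c: "c = h w"
        then have "R (h w) b" using bc sym by blast
        then have "b = w" using hD(3)[OF w] step(3) by (auto simp: isolated_def)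
        then show False using bc(1) w c by (simp add: cut_edges_def)
      qed
      moreover have "reach R {v, h w} w c"
        using step(3) bc \<open>c \<noteq> h w\<close> by (intro reach_step[of R _ w b c]) auto
      ultimately show ?case by blast
    qed (use wn in auto)
    then show ?thesis by blast
  qed
  have sepD: "separated ?Q v D"
    unfolding separated_def
  proof (intro conjI ballI impI)
    show "?Q v w" if "w \<in> D" for w
      using that DN hD(1)[OF that] irrD by (auto simp: cut_edges_def)
    show "w = w'" if "w \<in> D" "w' \<in> D" "reach ?Q {v} w w'" for w w'
      using inR[OF that(1,3)] hD(3)[OF that(1)] that(2) DN by (auto simp: isolated_def)
  qed
  \<comment> \<open>The two edges from the hub to its reserved pair survive: neither the pair nor
    the hub meets \<open>D\<close>.\<close>
  have hubs1: "h w \<in> hubs ?Q v A" if w: "w \<in> D" for w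
  proof -
    let ?y = "r w"
    have y: "?y \<in> Y" "w \<in> D' ?y" using r[OF w] by auto
    then have "card (A' ?y) = 2" using loc1(6)[OF y(1)] by blast
    then obtain a b where ab: "A' ?y = {a, b}" "a \<noteq> b" by (meson card_2_iff)
    have "?Q (h w) a" if a: "a \<in> A' ?y" for a
    proof -
      have Ra: "R (h w) a" "a \<in> S ?y" "a \<noteq> v"
        using loc1(1,7)[OF y(1)] a irrD by (auto simp: h_def S_def)
      have "a \<notin> D"
      proof
        assume "a \<in> D"
        then have "r a = ?y" using uniq[of "r a" ?y a a] r(1) rS Ra y(1) by simp
        then show False using r(2)[OF \<open>a \<in> D\<close>] a loc1(3)[OF y(1)] by auto
      qed
      moreover have "h w \<notin> D"
      proof
        assume d: "h w \<in> D"
        have "reach R {v} (h w) a" using Ra hD(1)[OF w] by (intro reach_edge) auto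
        then have "r (h w) = ?y" using uniq[of "r (h w)" ?y "h w" a] r(1) d rS Ra y(1) by simp
        then have "R (t ?y) (h w)" using r(2)[OF d] loc1(7)[OF y(1)] by auto
        then show False using irrD by (simp add: h_def)
      qed
      ultimately show ?thesis using Ra(1) by (simp add: cut_edges_def)
    qed
    then have "?Q (h w) a" "?Q (h w) b" using ab(1) by auto
    moreover have "a \<in> A" "b \<in> A" using ab(1) y(1) by (auto simp: A_def)
    ultimately show ?thesis using ab(2) hD(1)[OF w] unfolding hubs_def by blast
  qed
  \<comment> \<open>Two vertices of \<open>A\<close> with a common neighbour other than
    \<open>v\<close> belong to the same pair. If that neighbour were not the hub, it would connect
    them in the absence of \<open>v\<close> and the hub, against isolation.\<close>
  have hubs2: "hubs ?Q v A \<subseteq> t ` Y"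
  proof
    fix u assume "u \<in> hubs ?Q v A"
    then obtain a b where u: "u \<noteq> v" "a \<in> A" "b \<in> A" "a \<noteq> b" "R u a" "R u b"
      by (auto simp: hubs_def cut_edges_def)
    obtain y y' where y: "y \<in> Y" "a \<in> A' y" "y' \<in> Y" "b \<in> A' y'" using u(2,3) by (auto simp: A_def)
    have av: "a \<noteq> v" "b \<noteq> v" using u(2,3) AN irrD by auto
    have "reach R {v} a b"
      using reach_trans[OF reach_edge[of R a u] reach_edge[of R u b]] u av sym by auto
    then have "y = y'" using uniq[of y y' a b] y loc1(1) by blast
    have "u = t y"
    proof (rule ccontr)
      assume ut: "u \<noteq> t y"
      have "R (t y) a" "R (t y) b" using loc1(7)[OF y(1)] y \<open>y = y'\<close> by auto
      then have "a \<noteq> t y" "b \<noteq> t y" using irrD by auto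
      then have "reach R {v, t y} a b"
        using reach_trans[OF reach_edge[of R a u] reach_edge[of R u b]] u av sym ut by auto
      then show False using loc1(8)[OF y(1), of a] y(2) u AN by (auto simp: isolated_def)
    qed
    then show "u \<in> t ` Y" using y(1) by blast
  qed
  then have "finite (hubs ?Q v A)" "card (hubs ?Q v A) \<le> m"
    using YN(2) cardY finite_subset[OF hubs2] card_mono[OF _ hubs2] card_image_le[OF YN(2), of t] by auto
  then show ?thesis
    using AN DN D(2) hD(1,2) sepD hubs1
    by (intro exI[of _ A] exI[of _ D] exI[of _ h]) blast
qed

section \<open>Counting graphs by the degree of a vertex\<close>

definition degree_pairs :: "'a set \<Rightarrow> nat \<Rightarrow> nat \<Rightarrow> (('a \<Rightarrow> 'a \<Rightarrow> bool) \<times> 'a) set" where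
  "degree_pairs V k d = {(R, v). R \<in> graph_rels V k \<and> v \<in> V \<and> card {u. R v u} = d}"

text \<open>Cutting maps into \<open>separated_pairs V 6 k\<close>, and the graph is restored from
  \<open>A\<close>, \<open>D\<close> and \<open>h\<close>. The degree \<open>d\<close> of
  \<open>v\<close> survives the cut, so \<open>A\<close> and \<open>D\<close> together have at most
  \<open>4 ^ d\<close> choices; \<open>h\<close> has at most \<open>m ^ k\<close>.\<close>

lemma card_degree_pairs_diff:
  fixes V :: "'a set"
  assumes V: "finite V" and km: "3 * k + 15 * m \<le> d"
  shows "card (degree_pairs V 6 d - separated_pairs V 6 m) \<le> card (separated_pairs V 6 k) * (4 ^ d * m ^ k)"
proof -
  define T where "T = {p \<in> separated_pairs V 6 k. card {u. fst p (snd p) u} = d}"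
  \<comment> \<open>All admissible data for restoring a graph from the cut pair
    \<open>p\<close>.\<close>
  define C where "C = (\<lambda>p :: ('a \<Rightarrow> 'a \<Rightarrow> bool) \<times> 'a. 
     SIGMA AD : {A \<in> Pow {u. fst p (snd p) u}. finite (hubs (fst p) (snd p) A) \<and> card (hubs (fst p) (snd p) A) \<le> m}
       \<times> {D \<in> Pow {u. fst p (snd p) u}. card D = k}.
     snd AD \<rightarrow>\<^sub>E hubs (fst p) (snd p) (fst AD))"
  let ?f = "\<lambda>((R, v), ((A, D), h)). (add_edges R D h, v)"
  have finN: "finite {u. fst p (snd p) u}" if "p \<in> T" for p
    by (rule finite_subset[OF _ V]) (use that in \<open>auto simp: T_def separated_pairs_def graph_rels_def\<close>)
  have finT: "finite T" unfolding T_def using finite_separated_pairs[OF V] by simp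
  have finC: "finite (C p)" and cardC: "card (C p) \<le> 4 ^ d * m ^ k" if p: "p \<in> T" for p
  proof -
    let ?N = "{u. fst p (snd p) u}" and ?H = "hubs (fst p) (snd p)"
    let ?AD = "{A \<in> Pow ?N. finite (?H A) \<and> card (?H A) \<le> m} \<times> {D \<in> Pow ?N. card D = k}"
    have fAD: "finite ?AD" using finN[OF p] by auto
    have fs: "finite (snd AD \<rightarrow>\<^sub>E ?H (fst AD))" "card (snd AD \<rightarrow>\<^sub>E ?H (fst AD)) \<le> m ^ k" if "AD \<in> ?AD" for AD
    proof -
      have "finite (snd AD)" using that finite_subset[OF _ finN[OF p]] by auto
      then show "finite (snd AD \<rightarrow>\<^sub>E ?H (fst AD))" "card (snd AD \<rightarrow>\<^sub>E ?H (fst AD)) \<le> m ^ k"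
        using that by (auto intro!: finite_PiE simp: card_PiE power_mono)
    qed
    show "finite (C p)" unfolding C_def using fs(1) by (rule finite_SigmaI[OF fAD])
    have "card (C p) = (\<Sum>AD\<in>?AD. card (snd AD \<rightarrow>\<^sub>E ?H (fst AD)))"
      unfolding C_def using fs(1) by (intro card_SigmaI[OF fAD] ballI)
    also have "\<dots> \<le> card ?AD * m ^ k"
      using sum_bounded_above[of ?AD "\<lambda>AD. card (snd AD \<rightarrow>\<^sub>E ?H (fst AD))" "m ^ k"] fs by simp
    also have "card ?AD \<le> card (Pow ?N \<times> Pow ?N)" using finN[OF p] by (intro card_mono) auto
    also have "\<dots> = 4 ^ d"
      using finN[OF p] p by (simp add: card_cartesian_product card_Pow T_def power_mult_distrib[symmetric])
    finally show "card (C p) \<le> 4 ^ d * m ^ k" by simp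
  qed
  have "degree_pairs V 6 d - separated_pairs V 6 m \<subseteq> ?f ` Sigma T C"
  proof
    fix p assume p: "p \<in> degree_pairs V 6 d - separated_pairs V 6 m"
    obtain R v where Rv: "p = (R, v)" by (cases p)
    have R: "symp R" "irreflp R" "cycles_below 6 R" "\<And>a b. R a b \<Longrightarrow> a \<in> V \<and> b \<in> V" "v \<in> V"
      "card {u. R v u} = d" and few: "\<not> (\<exists>Y. finite Y \<and> card Y = m \<and> separated R v Y)"
      using p by (auto simp: Rv degree_pairs_def separated_pairs_def graph_rels_def)
    have "finite {u. R v u}" by (rule finite_subset[OF _ V]) (use R(4) in auto)
    from global_structure[OF R(1-3) this _ few, of k] km R(6) obtain A D h where
      st: "A \<subseteq> {u. R v u}" "D \<subseteq> {u. R v u}" "card D = k"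
      "\<forall>w\<in>D. h w \<noteq> v \<and> R (h w) w" "separated (cut_edges R D h) v D"
      "h ` D \<subseteq> hubs (cut_edges R D h) v A" "finite (hubs (cut_edges R D h) v A)"
      "card (hubs (cut_edges R D h) v A) \<le> m" by auto
    let ?Q = "cut_edges R D h"
    have "symp ?Q" "irreflp ?Q" using R(1,2) by (auto simp: cut_edges_def symp_def irreflp_def)
    moreover have "cycles_below 6 ?Q"
      by (rule cycles_below_mono[OF R(3)]) (simp add: cut_edges_def)
    ultimately have Q: "?Q \<in> graph_rels V 6"
      using R(4) unfolding graph_rels_def by (auto simp: cut_edges_def)
    have vD: "v \<notin> D" using st(2) R(2) by (auto simp: irreflp_def)
    then have N: "{u. ?Q v u} = {u. R v u}" using st(4) by (auto simp: cut_edges_def)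
    have "finite D" using finite_subset[OF st(2) \<open>finite {u. R v u}\<close>] .
    then have "(?Q, v) \<in> T" using Q R(5,6) st(3,5) N by (auto simp: T_def separated_pairs_def)
    \<comment> \<open>The extensional function space requires \<open>h\<close> to be undefined off
      \<open>D\<close>; \<open>add_edges\<close> reads it only on \<open>D\<close>.\<close>
    moreover have "((A, D), restrict h D) \<in> C (?Q, v)"
      unfolding C_def using N st by auto
    moreover have "?f ((?Q, v), ((A, D), restrict h D)) = p"
      using st(4) sympD[OF R(1)] by (auto simp: Rv add_edges_def cut_edges_def fun_eq_iff)
    ultimately show "p \<in> ?f ` Sigma T C" by (metis (lifting) SigmaI image_eqI)
  qed
  then have "card (degree_pairs V 6 d - separated_pairs V 6 m) \<le> card (?f ` Sigma T C)"
    using finT finC by (intro card_mono) auto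
  also have "\<dots> \<le> card (Sigma T C)" using finT finC by (intro card_image_le) auto
  also have "\<dots> = (\<Sum>p\<in>T. card (C p))" using finT finC by (intro card_SigmaI) auto
  also have "\<dots> \<le> card T * (4 ^ d * m ^ k)"
    using sum_bounded_above[of T "\<lambda>p. card (C p)" "4 ^ d * m ^ k"] cardC by simp
  also have "\<dots> \<le> card (separated_pairs V 6 k) * (4 ^ d * m ^ k)"
    using finite_separated_pairs[OF V] by (intro mult_right_mono card_mono) (auto simp: T_def)
  finally show ?thesis .
qed

text \<open>Either the pair already has \<open>m\<close> components, or cutting leads to one with
  \<open>k\<close>; \<open>card_separated_pairs\<close> bounds both.\<close>

lemma card_degree_pairs:
  assumes V: "finite V" and km: "3 * k + 15 * m \<le> d" "k > 0" "m > 0"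
  shows "real (card (degree_pairs V 6 d)) \<le>
    real (card (graph_rels V 6)) * (real (card V))\<^sup>2 * (1 / fact m + 4 ^ d * real m ^ k / fact k)"
proof -
  let ?G = "real (card (graph_rels V 6)) * (real (card V))\<^sup>2"
  have s: "real (card (separated_pairs V 6 j)) \<le> ?G / fact j" if "j > 0" for j
  proof -
    have "real (card (separated_pairs V 6 j) * fact j) \<le> real (card (graph_rels V 6) * card V * card V)"
      using card_separated_pairs[OF V that, of 6] of_nat_mono by blast
    then show ?thesis by (simp add: field_simps power2_eq_square)
  qed
  have fin: "finite (degree_pairs V 6 d)"
    by (rule finite_subset[of _ "graph_rels V 6 \<times> V"]) (auto simp: degree_pairs_def finite_graph_rels V)
  have "card (degree_pairs V 6 d) \<le> card (separated_pairs V 6 m \<union> (degree_pairs V 6 d - separated_pairs V 6 m))"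
    using fin finite_separated_pairs[OF V] by (intro card_mono) auto
  also have "\<dots> \<le> card (separated_pairs V 6 m) + card (separated_pairs V 6 k) * (4 ^ d * m ^ k)"
    using card_Un_le[of "separated_pairs V 6 m" "degree_pairs V 6 d - separated_pairs V 6 m"]
      card_degree_pairs_diff[OF V km(1)] by linarith
  finally have "real (card (degree_pairs V 6 d)) \<le>
      real (card (separated_pairs V 6 m) + card (separated_pairs V 6 k) * (4 ^ d * m ^ k))"
    by (rule of_nat_mono)
  also have "\<dots> = real (card (separated_pairs V 6 m)) + real (card (separated_pairs V 6 k)) * (4 ^ d * real m ^ k)"
    by simp
  also have "\<dots> \<le> ?G / fact m + ?G / fact k * (4 ^ d * real m ^ k)"
    using km s by (intro add_mono mult_right_mono) auto
  finally show ?thesis by (simp add: field_simps)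
qed

section \<open>Cycle minors\<close>

definition adj :: "'a ugraph \<Rightarrow> 'a \<Rightarrow> 'a \<Rightarrow> bool" where
  "adj G a b \<longleftrightarrow> {a, b} \<in> edges G"

lemma symp_adj: "symp (adj G)"
  by (auto simp: symp_def adj_def insert_commute)

text \<open>Walks inside \<open>B\<close> become walks avoiding its complement, so
  \<open>reach_imp_path\<close> yields simple paths within a branch set.\<close>

lemma connected_in_iff_reach:
  "connected_in G B \<longleftrightarrow> B \<noteq> {} \<and> B \<subseteq> verts G \<and> (\<forall>x\<in>B. \<forall>y\<in>B. reach (adj G) (- B) x y)"
proof -
  have "(x, y) \<in> {(u, v). u \<in> B \<and> v \<in> B \<and> {u, v} \<in> edges G}\<^sup>* \<longleftrightarrow> reach (adj G) (- B) x y" for x y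
    unfolding reach_def rtranclp_rtrancl_eq[symmetric] adj_def
    by (simp add: conj_ac)
  then show ?thesis unfolding connected_in_def by simp
qed

lemma connected_in_path:
  assumes "p \<noteq> []" "successively (adj G) p" "set p \<subseteq> verts G"
  shows "connected_in G (set p)"
proof -
  have "reach (adj G) (- set p) (hd p) u" if "u \<in> set p" for u
    using assms that by (intro path_imp_reach) auto
  then have "reach (adj G) (- set p) x y" if "x \<in> set p" "y \<in> set p" for x y
    using that reach_sym[OF symp_adj] reach_trans by metis
  then show ?thesis using assms by (auto simp: connected_in_iff_reach)
qed

text \<open>The first five vertices are singleton branch sets, and the remainder of the cycle is the
  sixth.\<close>

lemma cycle_imp_minor:
  assumes cyc: "is_cycle (adj G) xs" and len: "length xs \<ge> 6" and V: "set xs \<subseteq> verts G"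
  shows "minor_of (cycle_graph 6) G"
proof -
  have ne: "xs \<noteq> []" and dist: "distinct xs" and suc: "\<And>i. Suc i < length xs \<Longrightarrow> adj G (xs ! i) (xs ! Suc i)"
    and close: "adj G (last xs) (hd xs)"
    using cyc by (auto simp: is_cycle_def successively_conv_nth)
  define P where "P = (\<lambda>i. if i < 5 then [xs ! i] else drop 5 xs)"
  have conn: "connected_in G (set (P i))" for i
  proof (rule connected_in_path)
    show "P i \<noteq> []" using len by (auto simp: P_def)
    show "successively (adj G) (P i)"
      using suc[of "5 + j" for j] len by (auto simp: P_def successively_conv_nth)
    show "set (P i) \<subseteq> verts G"
      using V len by (auto simp: P_def dest: in_set_dropD)
  qed
  have notin: "xs ! i \<notin> set (drop 5 xs)" if "i < 5" for i
    using that dist len by (auto simp: in_set_conv_nth nth_eq_iff_index_eq)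
  have disj: "disjoint_family_on (\<lambda>i. set (P i)) (verts (cycle_graph 6))"
    unfolding disjoint_family_on_def
    using notin dist len by (auto simp: P_def cycle_graph_def nth_eq_iff_index_eq)
  have edge: "\<exists>x\<in>set (P i). \<exists>y\<in>set (P (Suc i mod 6)). adj G x y" if i: "i < 6" for i
  proof (cases "i < 5")
    case True
    have "xs ! 5 \<in> set (drop 5 xs)" using len by (auto simp: in_set_conv_nth intro!: exI[of _ 0])
    then have "xs ! Suc i \<in> set (P (Suc i mod 6))" using True by (cases "i = 4") (auto simp: P_def)
    then show ?thesis using suc[of i] True len by (auto simp: P_def)
  next
    case False
    then have "i = 5" using i by simp
    moreover have "last xs \<in> set (drop 5 xs)" using len last_in_set[of "drop 5 xs"] by simp
    ultimately show ?thesis using close ne by (auto simp: P_def hd_conv_nth)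
  qed
  show ?thesis unfolding minor_of_def
  proof (intro exI[of _ "\<lambda>i. set (P i)"] conjI ballI impI conn disj)
    fix u v assume "{u, v} \<in> edges (cycle_graph 6)"
    then obtain i where i: "i < 6" "{u, v} = {i, Suc i mod 6}" by (auto simp: cycle_graph_def)
    then have "(u = i \<and> v = Suc i mod 6) \<or> (v = i \<and> u = Suc i mod 6)" by (auto simp: doubleton_eq_iff)
    then show "\<exists>x\<in>set (P u). \<exists>y\<in>set (P v). {x, y} \<in> edges G"
      using edge[OF i(1)] by (metis adj_def insert_commute)
  qed
qed

text \<open>Paths inside the six disjoint branch sets, each from the entry to the exit vertex, are
  concatenated; each contributes at least one vertex.\<close>

lemma minor_imp_cycle:
  assumes "minor_of (cycle_graph 6) G"
  shows "\<exists>xs. is_cycle (adj G) xs \<and> length xs \<ge> 6"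
proof -
  have V: "verts (cycle_graph 6) = {0..<6}" by (simp add: cycle_graph_def)
  obtain B where B: "\<forall>i\<in>{0..<6}. connected_in G (B i)" "disjoint_family_on B {0..<6}"
    "\<forall>u\<in>{0..<6}. \<forall>v\<in>{0..<6}. {u, v} \<in> edges (cycle_graph 6) \<longrightarrow> (\<exists>x\<in>B u. \<exists>y\<in>B v. {x, y} \<in> edges G)"
    using assms unfolding minor_of_def V by blast
  then have conn: "\<And>i. i < 6 \<Longrightarrow> connected_in G (B i)"
    and disj: "disjoint_family_on B {0..<6}"
    and edge: "\<And>u v. u < 6 \<Longrightarrow> v < 6 \<Longrightarrow> {u, v} \<in> edges (cycle_graph 6) \<Longrightarrow> \<exists>x\<in>B u. \<exists>y\<in>B v. {x, y} \<in> edges G"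
    by auto
  have "\<exists>x y. x \<in> B i \<and> y \<in> B (Suc i mod 6) \<and> adj G x y" if "i < 6" for i
    using edge[of i "Suc i mod 6"] that by (auto simp: cycle_graph_def adj_def)
  \<comment> \<open>\<open>a i\<close> is the exit of \<open>B i\<close> and \<open>b i\<close> the
    entry of the next branch set, cyclically.\<close>
  then obtain a b where ab: "\<And>i. i < 6 \<Longrightarrow> a i \<in> B i" "\<And>i. i < 6 \<Longrightarrow> b i \<in> B (Suc i mod 6)"
    "\<And>i. i < 6 \<Longrightarrow> adj G (a i) (b i)" by metis
  have path: "\<exists>p. p \<noteq> [] \<and> hd p = x \<and> last p = y \<and> distinct p \<and> successively (adj G) p \<and> set p \<subseteq> B i"
    if xy: "i < 6" "x \<in> B i" "y \<in> B i" for i x y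
  proof -
    have "reach (adj G) (- B i) x y" "x \<notin> - B i"
      using conn[OF xy(1)] xy(2,3) by (auto simp: connected_in_iff_reach)
    then obtain p where "p \<noteq> []" "hd p = x" "last p = y" "distinct p"
      "successively (adj G) p" "set p \<inter> - B i = {}"
      by (rule reach_imp_path)
    then show ?thesis by blast
  qed
  obtain p0 where p0: "p0 \<noteq> []" "hd p0 = b 5" "last p0 = a 0" "distinct p0"
    "successively (adj G) p0" "set p0 \<subseteq> B 0"
    using path[of 0 "b 5" "a 0"] ab(1)[of 0] ab(2)[of 5] by auto
  obtain p1 where p1: "p1 \<noteq> []" "hd p1 = b 0" "last p1 = a 1" "distinct p1"
    "successively (adj G) p1" "set p1 \<subseteq> B 1"
    using path[of 1 "b 0" "a 1"] ab(1)[of 1] ab(2)[of 0] by auto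
  obtain p2 where p2: "p2 \<noteq> []" "hd p2 = b 1" "last p2 = a 2" "distinct p2"
    "successively (adj G) p2" "set p2 \<subseteq> B 2"
    using path[of 2 "b 1" "a 2"] ab(1)[of 2] ab(2)[of 1] by (auto simp: numeral_2_eq_2)
  obtain p3 where p3: "p3 \<noteq> []" "hd p3 = b 2" "last p3 = a 3" "distinct p3"
    "successively (adj G) p3" "set p3 \<subseteq> B 3"
    using path[of 3 "b 2" "a 3"] ab(1)[of 3] ab(2)[of 2] by auto
  obtain p4 where p4: "p4 \<noteq> []" "hd p4 = b 3" "last p4 = a 4" "distinct p4"
    "successively (adj G) p4" "set p4 \<subseteq> B 4"
    using path[of 4 "b 3" "a 4"] ab(1)[of 4] ab(2)[of 3] by auto
  obtain p5 where p5: "p5 \<noteq> []" "hd p5 = b 4" "last p5 = a 5" "distinct p5"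
    "successively (adj G) p5" "set p5 \<subseteq> B 5"
    using path[of 5 "b 4" "a 5"] ab(1)[of 5] ab(2)[of 4] by auto
  let ?xs = "p0 @ p1 @ p2 @ p3 @ p4 @ p5"
  have D: "set p \<inter> set q = {}" if "i < 6" "j < 6" "i \<noteq> j" "set p \<subseteq> B i" "set q \<subseteq> B j" for i j p q
    using that disjoint_family_onD[OF disj, of i j] by auto
  have "distinct ?xs"
    using p0(4) p1(4) p2(4) p3(4) p4(4) p5(4)
      D[OF _ _ _ p0(6) p1(6)] D[OF _ _ _ p0(6) p2(6)] D[OF _ _ _ p0(6) p3(6)]
      D[OF _ _ _ p0(6) p4(6)] D[OF _ _ _ p0(6) p5(6)] D[OF _ _ _ p1(6) p2(6)]
      D[OF _ _ _ p1(6) p3(6)] D[OF _ _ _ p1(6) p4(6)] D[OF _ _ _ p1(6) p5(6)]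
      D[OF _ _ _ p2(6) p3(6)] D[OF _ _ _ p2(6) p4(6)] D[OF _ _ _ p2(6) p5(6)]
      D[OF _ _ _ p3(6) p4(6)] D[OF _ _ _ p3(6) p5(6)] D[OF _ _ _ p4(6) p5(6)]
    by (simp add: Int_Un_distrib)
  moreover have "successively (adj G) ?xs"
    using p0 p1 p2 p3 p4 p5 ab(3)[of 0] ab(3)[of 1] ab(3)[of 2] ab(3)[of 3] ab(3)[of 4]
    by (simp add: successively_append_iff)
  moreover have "adj G (last ?xs) (hd ?xs)"
    using p0 p5 ab(3)[of 5] by simp
  ultimately have "is_cycle (adj G) ?xs" using p0(1) by (simp add: is_cycle_def)
  moreover have "length p \<ge> 1" if "p \<noteq> []" for p :: "'a list" using that by (cases p) auto
  from this[OF p0(1)] this[OF p1(1)] this[OF p2(1)] this[OF p3(1)] this[OF p4(1)] this[OF p5(1)]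
  have "length ?xs \<ge> 6" by simp
  ultimately show ?thesis by blast
qed

lemma adj_inj:
  assumes "simple_graph G" "simple_graph H" "verts G = verts H" "adj G = adj H"
  shows "G = H"
proof -
  have "e \<in> edges G \<longleftrightarrow> e \<in> edges H" for e
  proof (cases "card e = 2")
    case True
    then obtain a b where "e = {a, b}" by (meson card_2_iff)
    then show ?thesis using fun_cong[OF fun_cong[OF assms(4)], of a b] by (simp add: adj_def)
  next
    case False
    then show ?thesis using assms(1,2) by (auto simp: simple_graph_def)
  qed
  then show ?thesis using assms(3) by (intro prod_eqI) auto
qed

lemma adj_Ex_minor:
  assumes "G \<in> Ex_minor (cycle_graph 6) n"
  shows "adj G \<in> graph_rels {1..n} 6"
proof -
  have G: "simple_graph G" "verts G = {1..n}" "\<not> minor_of (cycle_graph 6) G"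
    using assms by (auto simp: Ex_minor_def labelled_graphs_def)
  have e: "a \<in> {1..n} \<and> b \<in> {1..n} \<and> a \<noteq> b" if "adj G a b" for a b
    using that G(1,2) by (auto simp: adj_def simple_graph_def subset_iff card_insert_if)
  have "cycles_below 6 (adj G)"
    unfolding cycles_below_def
  proof (intro allI impI)
    fix xs assume c: "is_cycle (adj G) xs"
    show "length xs < 6"
    proof (rule ccontr)
      assume l: "\<not> length xs < 6"
      have "set xs \<subseteq> verts G"
      proof
        fix x assume "x \<in> set xs"
        then obtain i where i: "i < length xs" "x = xs ! i" by (auto simp: in_set_conv_nth)
        have s: "\<And>i. Suc i < length xs \<Longrightarrow> adj G (xs ! i) (xs ! Suc i)"
          using c by (simp add: is_cycle_def successively_conv_nth)
        show "x \<in> verts G"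
          using s[of i] s[of "i - 1"] i l e G(2) by (cases "Suc i < length xs") auto
      qed
      then show False using cycle_imp_minor[OF c] l G(3) by simp
    qed
  qed
  then show ?thesis
    using e symp_adj unfolding graph_rels_def irreflp_def by blast
qed

text \<open>\<open>cycle_imp_minor\<close> puts the image into \<open>graph_rels\<close>, and
  \<open>minor_imp_cycle\<close> gives surjectivity.\<close>

lemma bij_betw_adj: "bij_betw adj (Ex_minor (cycle_graph 6) n) (graph_rels {1..n} 6)"
proof (rule bij_betwI')
  fix G H assume "G \<in> Ex_minor (cycle_graph 6) n" "H \<in> Ex_minor (cycle_graph 6) n"
  then show "adj G = adj H \<longleftrightarrow> G = H"
    using adj_inj[of G H] by (auto simp: Ex_minor_def labelled_graphs_def)
next
  fix R assume R: "R \<in> graph_rels {1..n} 6"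
  define G where "G = ({1..n}, {{a, b} | a b. R a b})"
  have *: "R a b = R b a" "\<not> R a a" "R a b \<Longrightarrow> a \<in> {1..n} \<and> b \<in> {1..n}" for a b
    using R by (auto simp: graph_rels_def irreflp_def symp_def)
  have adj: "adj G = R"
    using *(1) by (auto simp: adj_def G_def fun_eq_iff doubleton_eq_iff)
  have "simple_graph G"
    using *(2,3) by (fastforce simp: simple_graph_def G_def card_insert_if)
  moreover have "\<not> minor_of (cycle_graph 6) G"
    using minor_imp_cycle[of G] R unfolding adj by (force simp: graph_rels_def cycles_below_def)
  ultimately have "G \<in> Ex_minor (cycle_graph 6) n"
    by (auto simp: Ex_minor_def labelled_graphs_def G_def)
  then show "\<exists>G\<in>Ex_minor (cycle_graph 6) n. R = adj G" using adj by blast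
qed (rule adj_Ex_minor)

lemma vertex_degree_adj:
  assumes "simple_graph G"
  shows "vertex_degree G v = card {u. adj G v u}"
proof -
  have "bij_betw (\<lambda>u. {v, u}) {u. adj G v u} {e \<in> edges G. v \<in> e}"
  proof (rule bij_betwI')
    fix e assume "e \<in> {e \<in> edges G. v \<in> e}"
    moreover from this obtain a b where "e = {a, b}"
      using assms by (auto simp: simple_graph_def card_2_iff subset_iff)
    ultimately show "\<exists>u\<in>{u. adj G v u}. e = {v, u}"
      by (auto simp: adj_def insert_commute)
  qed (auto simp: adj_def doubleton_eq_iff)
  then show ?thesis unfolding vertex_degree_def by (metis bij_betw_same_card)
qed

section \<open>Asymptotics\<close>

text \<open>\<open>n ^ n / n!\<close> is one term of the exponential series at
  \<open>n\<close>.\<close>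

lemma power_self_le_fact_exp: "real n ^ n \<le> fact n * exp (real n)"
proof -
  have "sum (\<lambda>k. real n ^ k /\<^sub>R fact k) {n} \<le> (\<Sum>k. real n ^ k /\<^sub>R fact k)"
    using exp_converges[of "real n"] by (intro sum_le_suminf) (auto simp: sums_iff)
  then show ?thesis
    using exp_converges[of "real n"] by (simp add: field_simps sums_iff)
qed

lemma inverse_fact_le:
  assumes "n > 0"
  shows "1 / fact n \<le> exp (real n - real n * ln (real n))"
proof -
  have "exp (real n * ln (real n)) = real n ^ n"
    using assms by (simp add: exp_of_nat_mult)
  then have "exp (real n * ln (real n)) \<le> fact n * exp (real n)"
    using power_self_le_fact_exp[of n] by simp
  then show ?thesis by (simp add: exp_diff field_simps)
qed

text \<open>With \<open>m\<close> about \<open>d / sqrt (ln d)\<close> and \<open>k\<close> about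
  \<open>d / 6\<close>, the second term is at most \<open>4 ^ d * (e * m / k) ^ k\<close>, whose
  exponent is at most \<open>- d * ln (ln d) / 14 + O(d)\<close>; 15 in place of 14 absorbs the
  linear part. The first term is far smaller.\<close>

lemma degree_weight_bound:
  "eventually (\<lambda>d::nat. \<exists>k m. k > 0 \<and> m > 0 \<and> 3 * k + 15 * m \<le> d \<and>
     1 / fact m + 4 ^ d * real m ^ k / fact k \<le> 2 * exp (- (real d * ln (ln (real d)) / 15))) at_top"
proof -
  have e1: "eventually (\<lambda>d::nat. real d / sqrt (ln (real d)) \<ge> 3) at_top" by real_asymp
  have e2: "eventually (\<lambda>d::nat. 15 * (real d / sqrt (ln (real d)) + 1) + 3 * (real d / 6) \<le> real d) at_top"
    by real_asymp
  have e3: "eventually (\<lambda>d::nat. real d / 6 - 1 \<ge> real d / 7) at_top" by real_asymp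
  have e4: "eventually (\<lambda>d::nat. real d / sqrt (ln (real d)) * (ln (real d / sqrt (ln (real d))) - 1)
      \<ge> real d * ln (ln (real d)) / 15) at_top" by real_asymp
  have e5: "eventually (\<lambda>d::nat. 1 + ln (14 / sqrt (ln (real d))) \<le> 0) at_top" by real_asymp
  have e6: "eventually (\<lambda>d::nat. real d * ln 4 + real d / 7 * (1 + ln (14 / sqrt (ln (real d))))
      \<le> - (real d * ln (ln (real d)) / 15)) at_top" by real_asymp
  have e7: "eventually (\<lambda>d::nat. d \<ge> 7) at_top" by (rule eventually_ge_at_top)
  from e1 e2 e3 e4 e5 e6 e7 show ?thesis
  proof eventually_elim
    case (elim d)
    define y where "y = real d / sqrt (ln (real d))"
    define k where "k = d div 6"
    define m where "m = nat \<lceil>y\<rceil>"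
    note h = elim[folded y_def]
    have m: "real m \<ge> y" "real m \<le> y + 1" "m > 0" using h(1) by (auto simp: m_def)
    have kd: "real d / 6 - 1 \<le> real k" "real k \<le> real d / 6"
      unfolding k_def by linarith+
    then have k: "real k \<ge> real d / 7" "real k > 0" using h(3,7) by auto
    have "real (3 * k + 15 * m) \<le> real d" using h(2) m kd by simp
    then have sum: "3 * k + 15 * m \<le> d" by linarith
    have "y * (ln y - 1) \<le> real m * (ln (real m) - 1)"
    proof (rule mult_mono)
      show "ln y - 1 \<le> ln (real m) - 1" using m h(1) by simp
      have "exp 1 \<le> y" using h(1) exp_le by linarith
      then have "ln (exp 1) \<le> ln y" by (rule ln_mono) simp
      then show "0 \<le> ln y - 1" by simp
    qed (use m h(1) in auto)
    then have "real m - real m * ln (real m) \<le> - (real d * ln (ln (real d)) / 15)"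
      using h(4) by (simp add: algebra_simps)
    then have t1: "1 / fact m \<le> exp (- (real d * ln (ln (real d)) / 15))"
      using inverse_fact_le[OF m(3)] by (meson exp_le_cancel_iff order_trans)
    have "ln (real m / real k) \<le> ln (14 / sqrt (ln (real d)))"
    proof -
      \<comment> \<open>Here 14 is 2 times 7, from \<open>m <= y + 1 <= 2 * y\<close> and
        \<open>k >= d / 7\<close>.\<close>
      have "real m / real k \<le> (2 * y) / (real d / 7)"
        using m h(1,7) k by (intro frac_le) auto
      also have "\<dots> = 14 / sqrt (ln (real d))" using h(7) by (simp add: y_def)
      finally show ?thesis using m(3) k by (intro ln_mono) auto
    qed
    then have "real k * (1 + ln (real m / real k)) \<le> real k * (1 + ln (14 / sqrt (ln (real d))))"
      by (intro mult_left_mono) auto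
    \<comment> \<open>The factor is nonpositive, so the lower bound on \<open>k\<close> gives an
      upper bound on the product.\<close>
    also have "\<dots> \<le> real d / 7 * (1 + ln (14 / sqrt (ln (real d))))"
      using k(1) h(5) by (intro mult_right_mono_neg) auto
    finally have main: "real d * ln 4 + real k * (1 + ln (real m / real k)) \<le> - (real d * ln (ln (real d)) / 15)"
      using h(6) by linarith
    have "4 ^ d * real m ^ k / fact k = exp (real d * ln 4) * exp (real k * ln (real m)) * (1 / fact k)"
      using m(3) by (simp add: exp_of_nat_mult)
    also have "\<dots> \<le> exp (real d * ln 4) * exp (real k * ln (real m)) * exp (real k - real k * ln (real k))"
      using k by (intro mult_left_mono inverse_fact_le) auto
    also have "\<dots> = exp (real d * ln 4 + real k * (1 + ln (real m / real k)))"
      using m(3) k by (simp add: exp_add[symmetric] ln_div algebra_simps)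
    also have "\<dots> \<le> exp (- (real d * ln (ln (real d)) / 15))" using main by simp
    finally show ?case using t1 sum m(3) k by (intro exI[of _ k] exI[of _ m]) auto
  qed
qed

text \<open>A union bound over the degrees above the threshold \<open>g n\<close>: each has
  probability at most \<open>n^2 * 2 / n^4\<close>, and there are at most \<open>n + 1\<close> of
  them.\<close>

theorem theorem12:
  shows "\<exists>C::real. C > 0 \<and>
    (\<lambda>n::nat. measure_pmf.prob (pmf_of_set (Ex_minor (cycle_graph 6) n))
        {G. real (max_degree G) \<le> C * (ln (real n) / ln (ln (ln (real n))))})
      \<longlonglongrightarrow> 1"
\<comment> \<open>\<open>g n * ln (ln (g n))\<close> is asymptotically \<open>100 * ln n\<close>,
  and 100 / 15 exceeds the 4 needed in the exponent.\<close>
proof (intro exI[of _ "100 :: real"] conjI)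
  define g where "g = (\<lambda>n::nat. 100 * (ln (real n) / ln (ln (ln (real n)))))"
  define E where "E = (\<lambda>n. Ex_minor (cycle_graph 6) n)"
  let ?pr = "\<lambda>n. measure_pmf.prob (pmf_of_set (E n)) {G. real (max_degree G) \<le> g n}"
  obtain d0 where d0: "\<And>d. d \<ge> d0 \<Longrightarrow> \<exists>k m. k > 0 \<and> m > 0 \<and> 3 * k + 15 * m \<le> d \<and>
     1 / fact m + 4 ^ d * real m ^ k / fact k \<le> 2 * exp (- (real d * ln (ln (real d)) / 15))"
    using degree_weight_bound unfolding eventually_at_top_linorder by blast
  have e1: "eventually (\<lambda>n. g n * ln (ln (g n)) / 15 \<ge> 4 * ln (real n)) at_top"
    unfolding g_def by real_asymp
  have "filterlim g at_top at_top" unfolding g_def by real_asymp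
  then have e2: "eventually (\<lambda>n. g n \<ge> max 3 (real d0)) at_top"
    unfolding filterlim_at_top by blast
  have e3: "eventually (\<lambda>n::nat. n \<ge> 1) at_top" by (rule eventually_ge_at_top)
  have lower: "eventually (\<lambda>n. 1 - 2 * (real n + 1) / (real n)\<^sup>2 \<le> ?pr n) at_top"
    using e1 e2 e3
  proof eventually_elim
    case (elim n)
    let ?G = "graph_rels {1..n} 6"
    have finE: "finite (E n)" "E n \<noteq> {}"
      unfolding E_def by (simp_all add: finite_Ex_minor Ex_minor_cycle_nonempty)
    have cardE: "card (E n) = card ?G"
      unfolding E_def using bij_betw_adj by (rule bij_betw_same_card)
    define Bad where "Bad = {G \<in> E n. real (max_degree G) > g n}"
    define I where "I = {d. d \<le> n \<and> real d > g n}"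
    have "finite I" "card I \<le> n + 1"
      using card_mono[of "{..n}" I] by (auto simp: I_def)
    have finP: "finite (degree_pairs {1..n} 6 d)" for d
      by (rule finite_subset[of _ "?G \<times> {1..n}"]) (auto simp: degree_pairs_def finite_graph_rels)
    have sub: "adj ` Bad \<subseteq> (\<Union>d\<in>I. fst ` degree_pairs {1..n} 6 d)"
    proof
      fix R assume "R \<in> adj ` Bad"
      then obtain G where G: "G \<in> E n" "real (max_degree G) > g n" "R = adj G" by (auto simp: Bad_def)
      have s: "simple_graph G" "verts G = {1..n}" "R \<in> ?G"
        using G adj_Ex_minor[of G n] by (auto simp: E_def Ex_minor_def labelled_graphs_def)
      have "max_degree G \<in> vertex_degree G ` verts G"
        unfolding max_degree_def using s(2) elim(3) by (intro Max_in) auto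
      then obtain v where v: "v \<in> {1..n}" "max_degree G = vertex_degree G v" using s(2) by auto
      have d: "max_degree G = card {u. R v u}" using v vertex_degree_adj[OF s(1)] G(3) by simp
      have "card {u. R v u} \<le> card {1..n}"
        using s(3) by (intro card_mono) (auto simp: graph_rels_def)
      then have "max_degree G \<in> I" using G(2) d by (simp add: I_def)
      moreover have "(R, v) \<in> degree_pairs {1..n} 6 (max_degree G)"
        using s(3) v(1) d by (simp add: degree_pairs_def)
      ultimately show "R \<in> (\<Union>d\<in>I. fst ` degree_pairs {1..n} 6 d)" by force
    qed
    have each: "real (card (fst ` degree_pairs {1..n} 6 d)) \<le> real (card ?G) * (2 / (real n)\<^sup>2)"
      if d: "d \<in> I" for d
    proof -
      have dg: "real d > g n" "g n \<ge> 3" "g n \<ge> real d0" using d elim(2) by (auto simp: I_def)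
      then obtain k m where km: "k > 0" "m > 0" "3 * k + 15 * m \<le> d"
        "1 / fact m + 4 ^ d * real m ^ k / fact k \<le> 2 * exp (- (real d * ln (ln (real d)) / 15))"
        using d0[of d] by force
      \<comment> \<open>This makes \<open>ln (ln (g n))\<close> positive, so that the product grows
        from \<open>g n\<close> to \<open>d\<close>.\<close>
      have "1 < ln (g n)"
      proof -
        have "ln (exp 1) < ln (g n)" using dg(2) e_less_272 by (subst ln_less_cancel_iff) auto
        then show ?thesis by simp
      qed
      then have "g n * ln (ln (g n)) \<le> real d * ln (ln (real d))"
        using dg by (intro mult_mono) (auto intro!: ln_mono)
      then have "4 * ln (real n) \<le> real d * ln (ln (real d)) / 15" using elim(1) by linarith
      then have "exp (- (real d * ln (ln (real d)) / 15)) \<le> exp (- (4 * ln (real n)))" by simp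
      also have "\<dots> = 1 / real n ^ 4"
        using elim(3) exp_of_nat_mult[of 4 "ln (real n)"] by (simp add: exp_minus inverse_eq_divide)
      finally have w: "1 / fact m + 4 ^ d * real m ^ k / fact k \<le> 2 / real n ^ 4" using km(4) by linarith
      have "real (card (fst ` degree_pairs {1..n} 6 d)) \<le> real (card (degree_pairs {1..n} 6 d))"
        using card_image_le[OF finP] by simp
      also have "\<dots> \<le> real (card ?G) * (real (card {1..n}))\<^sup>2 * (1 / fact m + 4 ^ d * real m ^ k / fact k)"
        using km by (intro card_degree_pairs) auto
      also have "\<dots> \<le> real (card ?G) * (real n)\<^sup>2 * (2 / real n ^ 4)"
        using mult_left_mono[OF w, of "real (card ?G) * (real n)\<^sup>2"] by simp
      also have "\<dots> = real (card ?G) * (2 / (real n)\<^sup>2)"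
        using elim(3) by (simp add: field_simps power2_eq_square power4_eq_xxxx)
      finally show ?thesis .
    qed
    have "inj_on adj Bad"
      using bij_betw_adj[of n] by (auto simp: bij_betw_def E_def Bad_def intro: inj_on_subset)
    then have "real (card Bad) = real (card (adj ` Bad))" by (simp add: card_image)
    also have "\<dots> \<le> real (card (\<Union>d\<in>I. fst ` degree_pairs {1..n} 6 d))"
      using sub \<open>finite I\<close> finP by (intro of_nat_mono card_mono) auto
    also have "\<dots> \<le> real (\<Sum>d\<in>I. card (fst ` degree_pairs {1..n} 6 d))"
      using \<open>finite I\<close> by (intro of_nat_mono card_UN_le)
    also have "\<dots> = (\<Sum>d\<in>I. real (card (fst ` degree_pairs {1..n} 6 d)))" by simp
    also have "\<dots> \<le> (\<Sum>d\<in>I. real (card ?G) * (2 / (real n)\<^sup>2))" by (intro sum_mono each)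
    also have "\<dots> = real (card I) * (real (card ?G) * (2 / (real n)\<^sup>2))" by simp
    also have "\<dots> \<le> (real n + 1) * (real (card ?G) * (2 / (real n)\<^sup>2))"
      using \<open>card I \<le> n + 1\<close> by (intro mult_right_mono) auto
    finally have bad: "real (card Bad) \<le> (real n + 1) * (real (card (E n)) * (2 / (real n)\<^sup>2))"
      using cardE by simp
    have "card (E n \<inter> {G. real (max_degree G) \<le> g n}) = card (E n - Bad)"
      by (rule arg_cong[where f = card]) (auto simp: Bad_def)
    also have "\<dots> = card (E n) - card Bad"
      using finE by (intro card_Diff_subset) (auto simp: Bad_def)
    finally have "real (card (E n \<inter> {G. real (max_degree G) \<le> g n})) = real (card (E n)) - real (card Bad)"
      using card_mono[of "E n" Bad] finE by (simp add: Bad_def of_nat_diff)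
    then have "?pr n = (real (card (E n)) - real (card Bad)) / real (card (E n))"
      using measure_pmf_of_set[OF finE(2,1)] by simp
    moreover have pos: "card (E n) > 0" using finE by (simp add: card_gt_0_iff)
    ultimately have "?pr n = 1 - real (card Bad) / real (card (E n))"
      by (simp add: diff_divide_distrib)
    moreover have "real (card Bad) / real (card (E n)) \<le> (real n + 1) * (2 / (real n)\<^sup>2)"
      using bad pos by (subst pos_divide_le_eq) (simp_all add: algebra_simps)
    ultimately show ?case by (simp add: mult_ac)
  qed
  have "?pr \<longlonglongrightarrow> 1"
  proof (rule tendsto_sandwich[OF lower])
    show "eventually (\<lambda>n. ?pr n \<le> 1) at_top" by simp
    show "(\<lambda>n. 1 - 2 * (real n + 1) / (real n)\<^sup>2) \<longlonglongrightarrow> 1" by real_asymp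
  qed simp
  then show "(\<lambda>n::nat. measure_pmf.prob (pmf_of_set (Ex_minor (cycle_graph 6) n))
        {G. real (max_degree G) \<le> 100 * (ln (real n) / ln (ln (ln (real n))))}) \<longlonglongrightarrow> 1"
    by (simp add: g_def E_def)
qed simp

end
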